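(* Let $G=(V,E)$ be a bridgeless graph. Then the multivariate flow counting function $\varphi_G:\mathbb{Z}_{>0}^E\to\mathbb{Z}_{\ge 0}$, where $\varphi_G(\mathbf{k})$ is the number of nowhere-zero $\mathbf{k}$-flows on $G$, is a piecewise-defined polynomial in $\mathbf{k}=(k_e)_{e\in E}$ of degree $\xi_G$, where $\xi_G=|E|-|V|+\#\mathrm{components}(G)$ is the cyclomatic number of $G$.
   Context: Graphs $G=(V,E)$ are finite and may have multiple edges. A bridge is an edge whose removal increases the number of connected components of $G$; $G$ is bridgeless if it has no bridge. Fix an orientation of $G$: for each edge $e=uv\in E$, one of $u,v$ is designated the head $h(e)$ and the other the tail $t(e)$. An integral flow on $G$ (with respect to this orientation) is a vector $\mathbf{x}=(x_e)_{e\in E}\in\mathbb{Z}^E$ such that for every node $v\in V$, $$\sum_{h(e)=v}x_e=\sum_{t(e)=v}x_e.$$ For $\mathbf{k}\in\mathbb{Z}_{>0}^E$, a $\mathbf{k}$-flow on $G$ is an integral flow $\mathbf{x}\in\mathbb{Z}^E$ with $|x_e|<k_e$ for every $e\in E$. It is nowhere-zero if $x_e\neq 0$ for every $e\in E$. The number $\varphi_G(\mathbf{k})$ of nowhere-zero $\mathbf{k}$-flows does not depend on the chosen orientation. Piecewise-defined polynomial (in the standard sense for vector partition functions): a function $f:\mathbb{Z}_{>0}^E\to\mathbb{Z}$ is a piecewise-defined polynomial of degree $d$ if there are finitely many full-dimensional closed convex rational polyhedral cones $C_1,\dots,C_m$ whose union is $\mathbb{R}_{\ge0}^E$, and polynomials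 $p_1,\dots,p_m\in\mathbb{Q}[k_e: e\in E]$, each of total degree $d$, such that $f(\mathbf{k})=p_i(\mathbf{k})$ for all $\mathbf{k}\in C_i\cap\mathbb{Z}_{>0}^E$ and all $i$. *)

theory Defs
  imports Complex_Main "HOL-Library.FuncSet" "HOL-Library.Poly_Mapping"
begin

text \<open>
  An undirected finite multigraph: every edge name \<open>e \<in> E\<close> carries its set of endpoints, so
  parallel edges are different names with the same endpoints. An edge with a single endpoint
  is a loop; loops are permitted.
\<close>

locale finite_multigraph =
  fixes V :: "'v set" and E :: "'e set" and ends :: "'e \<Rightarrow> 'v set"
  assumes finite_V: "finite V"
    and finite_E: "finite E"
    and ends_in_V: "e \<in> E \<Longrightarrow> \<exists>u\<in>V. \<exists>v\<in>V. ends e = {u, v}"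

definition adjacent :: "'e set \<Rightarrow> ('e \<Rightarrow> 'v set) \<Rightarrow> ('v \<times> 'v) set" where
  "adjacent E ends = {(u, v). \<exists>e\<in>E. ends e = {u, v}}"

definition components :: "'v set \<Rightarrow> 'e set \<Rightarrow> ('e \<Rightarrow> 'v set) \<Rightarrow> 'v set set" where
  "components V E ends = V // {(u, v). u \<in> V \<and> v \<in> V \<and> (u, v) \<in> (adjacent E ends)\<^sup>*}"

definition is_bridge :: "'v set \<Rightarrow> 'e set \<Rightarrow> ('e \<Rightarrow> 'v set) \<Rightarrow> 'e \<Rightarrow> bool" where
  "is_bridge V E ends e \<longleftrightarrow>
     e \<in> E \<and> card (components V (E - {e}) ends) > card (components V E ends)"

definition bridgeless :: "'v set \<Rightarrow> 'e set \<Rightarrow> ('e \<Rightarrow> 'v set) \<Rightarrow> bool" where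
  "bridgeless V E ends \<longleftrightarrow> (\<nexists>e. is_bridge V E ends e)"

text \<open>
  The natural-number subtraction does not truncate: each edge joins at most two components,
  so \<open>card V \<le> card E + card (components V E ends)\<close> in every finite multigraph.
\<close>

definition cyclomatic_number :: "'v set \<Rightarrow> 'e set \<Rightarrow> ('e \<Rightarrow> 'v set) \<Rightarrow> nat" where
  "cyclomatic_number V E ends = card E + card (components V E ends) - card V"

definition is_orientation ::
    "'e set \<Rightarrow> ('e \<Rightarrow> 'v set) \<Rightarrow> ('e \<Rightarrow> 'v) \<Rightarrow> ('e \<Rightarrow> 'v) \<Rightarrow> bool" where
  "is_orientation E ends h t \<longleftrightarrow> (\<forall>e\<in>E. ends e = {h e, t e})"

text \<open>
  Vectors indexed by \<open>E\<close> are functions that are \<open>undefined\<close> outside \<open>E\<close> (the extensional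
  function space), so that they are determined by their values on \<open>E\<close>.
\<close>

definition integral_flows ::
    "'v set \<Rightarrow> 'e set \<Rightarrow> ('e \<Rightarrow> 'v) \<Rightarrow> ('e \<Rightarrow> 'v) \<Rightarrow> ('e \<Rightarrow> int) set" where
  "integral_flows V E h t =
     {x \<in> E \<rightarrow>\<^sub>E UNIV. \<forall>v\<in>V. (\<Sum>e\<in>{e\<in>E. h e = v}. x e) = (\<Sum>e\<in>{e\<in>E. t e = v}. x e)}"

definition nowhere_zero_k_flows ::
    "'v set \<Rightarrow> 'e set \<Rightarrow> ('e \<Rightarrow> 'v) \<Rightarrow> ('e \<Rightarrow> 'v) \<Rightarrow> ('e \<Rightarrow> int) \<Rightarrow> ('e \<Rightarrow> int) set" where
  "nowhere_zero_k_flows V E h t k =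
     {x \<in> integral_flows V E h t. (\<forall>e\<in>E. \<bar>x e\<bar> < k e) \<and> (\<forall>e\<in>E. x e \<noteq> 0)}"

lemma finite_nowhere_zero_k_flows:
  assumes "finite E"
  shows "finite (nowhere_zero_k_flows V E h t k)"
proof (rule finite_subset)
  show "nowhere_zero_k_flows V E h t k \<subseteq> (\<Pi>\<^sub>E e\<in>E. {- k e..k e})"
    by (force simp: nowhere_zero_k_flows_def integral_flows_def PiE_iff)
  show "finite (\<Pi>\<^sub>E e\<in>E. {- k e..k e})"
    using assms by (intro finite_PiE) auto
qed

definition flow_count ::
    "'v set \<Rightarrow> 'e set \<Rightarrow> ('e \<Rightarrow> 'v) \<Rightarrow> ('e \<Rightarrow> 'v) \<Rightarrow> ('e \<Rightarrow> int) \<Rightarrow> nat" where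
  "flow_count V E h t k = card (nowhere_zero_k_flows V E h t k)"

text \<open>
  A finite intersection of homogeneous half-spaces with rational normal vectors. Such a set is
  automatically a closed convex cone.
\<close>

definition rational_polyhedral_cone :: "'e set \<Rightarrow> ('e \<Rightarrow> real) set \<Rightarrow> bool" where
  "rational_polyhedral_cone E C \<longleftrightarrow>
     (\<exists>A :: ('e \<Rightarrow> rat) set. finite A \<and>
        C = {x \<in> E \<rightarrow>\<^sub>E UNIV. \<forall>a\<in>A. 0 \<le> (\<Sum>e\<in>E. of_rat (a e) * x e)})"

text \<open>
  The dimension of a cone is the dimension of its linear span, so a cone is full-dimensional
  iff its linear span is the whole space.
\<close>

definition full_dimensional :: "'e set \<Rightarrow> ('e \<Rightarrow> real) set \<Rightarrow> bool" where
  "full_dimensional E C \<longleftrightarrow>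
     (\<forall>y \<in> E \<rightarrow>\<^sub>E UNIV. \<exists>S c. finite S \<and> S \<subseteq> C \<and> (\<forall>e\<in>E. y e = (\<Sum>s\<in>S. c s * s e)))"

text \<open>
  Multivariate polynomials with rational coefficients in variables named by \<open>'e\<close>: a monomial is
  a finitely supported exponent vector, a polynomial a finitely supported coefficient function.
\<close>

type_synonym 'e rat_mpoly = "('e \<Rightarrow>\<^sub>0 nat) \<Rightarrow>\<^sub>0 rat"

definition polys_over :: "'e set \<Rightarrow> 'e rat_mpoly set" where
  "polys_over E = {p. \<forall>m \<in> Poly_Mapping.keys p. Poly_Mapping.keys m \<subseteq> E}"

definition eval_mpoly :: "'e rat_mpoly \<Rightarrow> ('e \<Rightarrow> rat) \<Rightarrow> rat" where
  "eval_mpoly p x =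
     (\<Sum>m\<in>Poly_Mapping.keys p.
        Poly_Mapping.lookup p m * (\<Prod>e\<in>Poly_Mapping.keys m. x e ^ Poly_Mapping.lookup m e))"

definition monomial_degree :: "('e \<Rightarrow>\<^sub>0 nat) \<Rightarrow> nat" where
  "monomial_degree m = (\<Sum>e\<in>Poly_Mapping.keys m. Poly_Mapping.lookup m e)"

text \<open>The zero polynomial does not have any natural number as its total degree.\<close>

definition has_total_degree :: "'e rat_mpoly \<Rightarrow> nat \<Rightarrow> bool" where
  "has_total_degree p d \<longleftrightarrow> p \<noteq> 0 \<and> Max (monomial_degree ` Poly_Mapping.keys p) = d"

text \<open>Only the values of \<open>f\<close> at positive integer vectors over \<open>E\<close> matter.\<close>

definition piecewise_polynomial_of_degree ::
    "'e set \<Rightarrow> (('e \<Rightarrow> int) \<Rightarrow> int) \<Rightarrow> nat \<Rightarrow> bool" where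
  "piecewise_polynomial_of_degree E f d \<longleftrightarrow>
     (\<exists>(m :: nat) (C :: nat \<Rightarrow> ('e \<Rightarrow> real) set) (p :: nat \<Rightarrow> 'e rat_mpoly).
        (\<forall>i<m. rational_polyhedral_cone E (C i) \<and> full_dimensional E (C i)) \<and>
        (\<Union>i<m. C i) = (E \<rightarrow>\<^sub>E {0..}) \<and>
        (\<forall>i<m. p i \<in> polys_over E \<and> has_total_degree (p i) d) \<and>
        (\<forall>i<m. \<forall>k \<in> E \<rightarrow>\<^sub>E {0<..}. (\<lambda>e\<in>E. real_of_int (k e)) \<in> C i \<longrightarrow>
           of_int (f k) = eval_mpoly (p i) (\<lambda>e. of_int (k e))))"

end

theory Submission imports Defs "HOL-Computational_Algebra.Polynomial"
begin

text \<open>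
  Why the count is piecewise polynomial. Nowhere-zero flows are sorted by the signs of their values.
  For a fixed sign pattern they are the vectors of the flow lattice whose coordinates, taken with both
  signs, lie strictly below certain bounds, and these bounds are 0 or entries of \<open>k\<close>. So it suffices to
  understand how the number of lattice vectors with \<open>x i < a i\<close> depends on arbitrary bounds \<open>a\<close>.
  When \<open>a i\<close> crosses an integer \<open>n\<close> from below, the number grows by the number of vectors with \<open>x i = n\<close>.
  The flow lattice is unimodular: if coordinate \<open>i\<close> is not identically zero, some
  vector \<open>c\<close> has \<open>c i = 1\<close>, and subtracting \<open>n\<close> times \<open>c\<close> turns the slice into the same problem for the
  sublattice \<open>x i = 0\<close> with one coordinate fewer (\<open>card_points_raise_bound\<close>). By induction the jumps
  are polynomials in the bounds rounded up, as long as \<open>a\<close> stays in a chamber of a finite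
  arrangement of hyperplanes, and a function with polynomial jumps is polynomial on each chamber
  (\<open>polynomial_on_chamber_if_differences_polynomial\<close>, \<open>points_chamberwise_polynomial\<close>).

  The statement is about closed cones, so vectors \<open>k\<close> on walls need a separate argument. The bounds are real
  numbers and the inequalities are strict, so lowering the bounds by less than 1 changes nothing; for
  positive \<open>k\<close> this freedom suffices to move the bounds into the open chamber that belongs to
  the cone (\<open>perturbed_bounds\<close>).

  Why the degree is the cyclomatic number. A flow is determined by as many coordinates as there are fundamental circuits,
  and in a bridgeless graph a nowhere-zero flow can be perturbed freely in the direction of
  all these circuits. Hence the number of flows for \<open>q T k\<close> lies between two constant multiples of
  \<open>q\<close> to the power of the cyclomatic number (\<open>card_nz_flows_growth\<close>). In every full-dimensional cone some
  integer vector is not a zero of the leading form, and along its ray the growth of the count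
  reveals the degree (\<open>minimal_degree_eq_growth\<close>).
\<close>

section \<open>Polynomial functions in several variables\<close>

text \<open>
  A polynomial function has degree at most \<open>d\<close> here; the representation by a polynomial is kept out
  of sight until the very end, because substitution and summation are simpler for functions.
\<close>

inductive polyfn :: "'i set \<Rightarrow> nat \<Rightarrow> (('i \<Rightarrow> rat) \<Rightarrow> rat) \<Rightarrow> bool" for I where
  const: "polyfn I d (\<lambda>_. c)"
| var_mult: "polyfn I d f \<Longrightarrow> i \<in> I \<Longrightarrow> polyfn I (Suc d) (\<lambda>x. x i * f x)"
| add: "polyfn I d f \<Longrightarrow> polyfn I d g \<Longrightarrow> polyfn I d (\<lambda>x. f x + g x)"

lemma polyfn_mono: "polyfn I d f \<Longrightarrow> d \<le> d' \<Longrightarrow> polyfn I d' f"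
proof (induction arbitrary: d' rule: polyfn.induct)
  case (var_mult d f i)
  then obtain d'' where "d' = Suc d''" "d \<le> d''" by (cases d') auto
  with var_mult show ?case by (auto intro: polyfn.var_mult)
qed (auto intro: polyfn.intros)

lemma polyfn_cmult: "polyfn I d f \<Longrightarrow> polyfn I d (\<lambda>x. c * f x)"
proof (induction rule: polyfn.induct)
  case (var_mult d f i)
  then show ?case using polyfn.var_mult[of I d "\<lambda>x. c * f x" i]
    by (simp add: mult.left_commute)
qed (auto simp: distrib_left intro: polyfn.intros)

lemma polyfn_var: "i \<in> I \<Longrightarrow> polyfn I (Suc d) (\<lambda>x. x i)"
  using polyfn.var_mult[OF polyfn.const[of I d 1]] by simp

lemma polyfn_mult: "polyfn I d f \<Longrightarrow> polyfn I d' g \<Longrightarrow> polyfn I (d + d') (\<lambda>x. f x * g x)"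
proof (induction rule: polyfn.induct)
  case (const d c)
  then show ?case by (auto intro: polyfn_cmult polyfn_mono)
next
  case (var_mult d f i)
  then show ?case using polyfn.var_mult[of I "d + d'" "\<lambda>x. f x * g x" i]
    by (simp add: mult.assoc)
qed (auto simp: distrib_right intro: polyfn.intros)

lemma polyfn_diff: "polyfn I d f \<Longrightarrow> polyfn I d g \<Longrightarrow> polyfn I d (\<lambda>x. f x - g x)"
  using polyfn.add[OF _ polyfn_cmult[of I d g "-1"]] by fastforce

lemma polyfn_sum:
  "(\<And>j. j \<in> A \<Longrightarrow> polyfn I d (f j)) \<Longrightarrow> polyfn I d (\<lambda>x. \<Sum>j\<in>A. f j x)"
  by (induction A rule: infinite_finite_induct) (auto intro: polyfn.intros)

lemma polyfn_affine_subst: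
  assumes "polyfn I d f" and "\<And>j. j \<in> I \<Longrightarrow> polyfn K 1 (s j)"
  shows "polyfn K d (\<lambda>x. f (\<lambda>j. s j x))"
  using assms
proof (induction rule: polyfn.induct)
  case (var_mult d f i)
  then show ?case using polyfn_mult[of K 1 "s i" d "\<lambda>x. f (\<lambda>j. s j x)"] by simp
qed (auto intro: polyfn.intros)

lemma polyfn_cong_vars:
  "polyfn I d f \<Longrightarrow> (\<And>i. i \<in> I \<Longrightarrow> x i = y i) \<Longrightarrow> f x = f y"
  by (induction rule: polyfn.induct) auto

lemma polyfn_upd:
  assumes "polyfn I d f" shows "polyfn I d (\<lambda>x. f (x(i := c)))"
proof -
  have "polyfn I d (\<lambda>x. f (\<lambda>j. if j = i then c else x j))"
  proof (rule polyfn_affine_subst[OF assms])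
    fix j assume "j \<in> I"
    then show "polyfn I 1 (\<lambda>x. if j = i then c else x j)"
      using polyfn_var[of j I 0] by (cases "j = i") (auto intro: polyfn.const)
  qed
  then show ?thesis unfolding fun_upd_def .
qed

lemma polyfn_shift:
  assumes "polyfn I d f" shows "polyfn I d (\<lambda>x. f (x(i := x i + c)))"
proof -
  have "polyfn I d (\<lambda>x. f (\<lambda>j. if j = i then x i + c else x j))"
  proof (rule polyfn_affine_subst[OF assms])
    fix j assume "j \<in> I"
    then show "polyfn I 1 (\<lambda>x. if j = i then x i + c else x j)"
      using polyfn_var[of j I 0]
      by (cases "j = i") (auto intro!: polyfn.add polyfn.const)
  qed
  then show ?thesis unfolding fun_upd_def .
qed

lemma polyfn_univariate:
  "polyfn I d f \<Longrightarrow> \<exists>p. degree p \<le> d \<and> (\<forall>t. poly p t = f (x(i := t)))"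
proof (induction rule: polyfn.induct)
  case (const d c)
  show ?case by (rule exI[of _ "[:c:]"]) auto
next
  case (var_mult d f j)
  from var_mult.IH obtain p where p: "degree p \<le> d" "\<And>t. poly p t = f (x(i := t))" by blast
  show ?case
  proof (cases "j = i")
    case True
    with p show ?thesis
      by (intro exI[of _ "pCons 0 p"]) (auto simp: fun_upd_def intro: order_trans[OF degree_pCons_le])
  next
    case False
    with p show ?thesis
      by (intro exI[of _ "smult (x j) p"]) (auto simp: fun_upd_def intro: order_trans[OF degree_smult_le])
  qed
next
  case (add d f g)
  from add.IH obtain p q where "degree p \<le> d" "\<And>t. poly p t = f (x(i := t))"
     "degree q \<le> d" "\<And>t. poly q t = g (x(i := t))" by blast
  then show ?case by (intro exI[of _ "p + q"]) (auto simp: fun_upd_def intro: degree_add_le)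
qed

text \<open>
  Fixing all variables but one leaves a univariate polynomial with more roots than its degree, so the
  coordinates can be released from the grid one after another.
\<close>

lemma polyfn_eq_0_if_grid:
  assumes f: "polyfn I d f" and "finite I"
    and T: "\<And>i. i \<in> I \<Longrightarrow> finite (T i) \<and> d < card (T i)"
    and zero: "\<And>x. (\<And>i. i \<in> I \<Longrightarrow> x i \<in> T i) \<Longrightarrow> f x = 0"
  shows "f x = 0"
proof -
  have "f x = 0" if "K \<subseteq> I" "\<And>i. i \<in> I - K \<Longrightarrow> x i \<in> T i" for K x
    using finite_subset[OF that(1) \<open>finite I\<close>] that
  proof (induction K arbitrary: x rule: finite_induct)
    case empty
    then show ?case using zero by auto
  next
    case (insert i K)
    obtain p where p: "degree p \<le> d" "\<And>t. poly p t = f (x(i := t))"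
      using polyfn_univariate[OF f] by blast
    have root: "poly p t = 0" if "t \<in> T i" for t
      unfolding p(2) using insert.prems that by (intro insert.IH) auto
    have "p = 0"
    proof (rule ccontr)
      assume "p \<noteq> 0"
      then have "card (T i) \<le> card {t. poly p t = 0}"
        using root by (intro card_mono poly_roots_finite) auto
      also have "\<dots> \<le> d" using card_poly_roots_bound[OF \<open>p \<noteq> 0\<close>] p(1) by linarith
      finally show False using T[of i] insert.prems by auto
    qed
    then show ?case using p(2)[of "x i"] by simp
  qed
  from this[of I] show ?thesis by simp
qed

text \<open>
  In the basis of binomial coefficients the antidifference is a shift of the lower index. For the
  induction the claim is strengthened to products of \<open>f\<close> with a binomial coefficient: a factor
  \<open>x i\<close> of \<open>f\<close> is absorbed by \<open>y * (y gchoose k) = (k + 1) * (y gchoose (k + 1)) + k * (y gchoose k)\<close>.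
\<close>

lemma polyfn_antidifference:
  assumes "polyfn I d f" and "i \<in> I"
  obtains R where "polyfn I (Suc d) R" "\<And>x. R (x(i := x i + 1)) - R x = f x"
proof -
  have gch: "polyfn I k (\<lambda>x. x i gchoose k)" for k
  proof (induction k)
    case (Suc k)
    have eq: "(y gchoose Suc k) = (1 / of_nat (Suc k)) * ((y - of_nat k) * (y gchoose k))" for y :: rat
      using gbinomial_absorb_comp[of y k] gbinomial_absorption[of k "y"]
      by (simp add: field_simps del: of_nat_Suc)
    have "polyfn I (1 + k) (\<lambda>x. (x i - of_nat k) * (x i gchoose k))"
      by (intro polyfn_mult Suc polyfn_diff polyfn.const)
        (use polyfn_var[OF assms(2), of 0] in simp)
    then show ?case unfolding eq by (intro polyfn_cmult) simp
  qed (simp add: polyfn.const)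
  have "\<exists>R. polyfn I (Suc (d + k)) R \<and>
        (\<forall>x. R (x(i := x i + 1)) - R x = (x i gchoose k) * f x)" for k
    using assms(1)
  proof (induction arbitrary: k rule: polyfn.induct)
    case (const d c)
    show ?case
    proof (intro exI conjI allI)
      show "polyfn I (Suc (d + k)) (\<lambda>x. c * (x i gchoose Suc k))"
        by (rule polyfn_cmult, rule polyfn_mono[OF gch]) simp
      show "c * ((x(i := x i + 1)) i gchoose Suc k) - c * (x i gchoose Suc k) = (x i gchoose k) * c" for x
        by (simp add: gbinomial_Suc_Suc distrib_left)
    qed
  next
    case (var_mult d f j)
    show ?case
    proof (cases "j = i")
      case False
      obtain R where R: "polyfn I (Suc (d + k)) R"
        "\<And>x. R (x(i := x i + 1)) - R x = (x i gchoose k) * f x"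
        using var_mult.IH by blast
      show ?thesis
      proof (intro exI conjI allI)
        show "polyfn I (Suc (Suc d + k)) (\<lambda>x. x j * R x)"
          using polyfn.var_mult[OF R(1) var_mult.hyps(2)] by simp
        show "(x(i := x i + 1)) j * R (x(i := x i + 1)) - x j * R x = (x i gchoose k) * (x j * f x)" for x
          using R(2)[of x] False by (auto simp: algebra_simps)
      qed
    next
      case True
      obtain R where R: "polyfn I (Suc (d + k)) R"
        "\<And>x. R (x(i := x i + 1)) - R x = (x i gchoose k) * f x"
        using var_mult.IH by blast
      obtain R' where R': "polyfn I (Suc (d + Suc k)) R'"
        "\<And>x. R' (x(i := x i + 1)) - R' x = (x i gchoose Suc k) * f x"
        using var_mult.IH by blast
      have eq: "y * (y gchoose k) = of_nat (Suc k) * (y gchoose Suc k) + of_nat k * (y gchoose k)"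
        for y :: rat
        using gbinomial_absorb_comp[of y k] gbinomial_absorption[of k "y"]
        by (simp add: algebra_simps del: of_nat_Suc)
      show ?thesis
      proof (intro exI conjI allI)
        show "polyfn I (Suc (Suc d + k)) (\<lambda>x. of_nat (Suc k) * R' x + of_nat k * R x)"
          by (intro polyfn.add polyfn_cmult polyfn_mono[OF R(1)] polyfn_mono[OF R'(1)]) auto
        fix x
        have "of_nat (Suc k) * R' (x(i := x i + 1)) + of_nat k * R (x(i := x i + 1)) -
           (of_nat (Suc k) * R' x + of_nat k * R x)
          = of_nat (Suc k) * (R' (x(i := x i + 1)) - R' x) + of_nat k * (R (x(i := x i + 1)) - R x)"
          by (simp add: algebra_simps)
        also have "\<dots> = (x i * (x i gchoose k)) * f x"
          unfolding R R' eq by (simp add: algebra_simps)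
        finally show "of_nat (Suc k) * R' (x(i := x i + 1)) + of_nat k * R (x(i := x i + 1)) -
           (of_nat (Suc k) * R' x + of_nat k * R x) = (x i gchoose k) * (x j * f x)"
          using True by (simp add: mult_ac)
      qed
    qed
  next
    case (add d f g)
    obtain R R' where "polyfn I (Suc (d + k)) R"
        "\<And>x. R (x(i := x i + 1)) - R x = (x i gchoose k) * f x"
        "polyfn I (Suc (d + k)) R'"
        "\<And>x. R' (x(i := x i + 1)) - R' x = (x i gchoose k) * g x"
      using add.IH by meson
    then show ?case
      by (intro exI[of _ "\<lambda>x. R x + R' x"])
        (auto intro: polyfn.add simp: algebra_simps diff_eq_eq fun_upd_def)
  qed
  from this[of 0] that show ?thesis by auto
qed

section \<open>Chambers of hyperplane arrangements\<close>

definition lin :: "'i set \<Rightarrow> ('i \<Rightarrow> int) \<Rightarrow> ('i \<Rightarrow> real) \<Rightarrow> real" where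
  "lin I l a = (\<Sum>i\<in>I. of_int (l i) * a i)"

text \<open>
  The values of \<open>s\<close> on \<open>W\<close> will always be nonzero, which makes a chamber an open convex cone,
  possibly empty. Only the coordinates in \<open>I\<close> matter for membership.
\<close>

definition chamber :: "'i set \<Rightarrow> ('i \<Rightarrow> int) set \<Rightarrow> (('i \<Rightarrow> int) \<Rightarrow> real) \<Rightarrow> ('i \<Rightarrow> real) set" where
  "chamber I W s = {a. \<forall>l\<in>W. sgn (lin I l a) = s l}"

lemma lin_cong: "(\<And>i. i \<in> I \<Longrightarrow> a i = b i) \<Longrightarrow> lin I l a = lin I l b"
  by (simp add: lin_def)

lemma lin_add: "lin I l (\<lambda>i. a i + b i) = lin I l a + lin I l b"
  by (simp add: lin_def sum.distrib distrib_left)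

lemma lin_diff: "lin I l (\<lambda>i. a i - b i) = lin I l a - lin I l b"
  by (simp add: lin_def sum_subtractf right_diff_distrib)

lemma lin_cmult: "lin I l (\<lambda>i. r * a i) = r * lin I l a"
  by (simp add: lin_def sum_distrib_left mult_ac)

lemma chamber_scale: "a \<in> chamber I W s \<Longrightarrow> 0 < r \<Longrightarrow> (\<lambda>i. r * a i) \<in> chamber I W s"
  by (simp add: chamber_def lin_cmult sgn_mult)

lemma sgn_convex_combination:
  fixes x y t :: real
  assumes "sgn x = s" "sgn y = s" "0 \<le> t" "t \<le> 1"
  shows "sgn (x + t * (y - x)) = s"
proof -
  have eq: "x + t * (y - x) = (1 - t) * x + t * y" by (simp add: algebra_simps)
  consider "x = 0" "y = 0" | "x > 0" "y > 0" | "x < 0" "y < 0"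
    using assms by (auto simp: sgn_if split: if_splits)
  then show ?thesis
  proof cases
    case 2
    then have "(1 - t) * x + t * y > 0"
      using assms by (cases "t = 0") (auto intro: add_nonneg_pos)
    with 2 assms eq show ?thesis by simp
  next
    case 3
    then have "(1 - t) * x + t * y < 0"
      using assms by (cases "t = 0")
        (auto intro!: add_nonpos_neg simp: mult_nonneg_nonpos mult_pos_neg)
    with 3 assms eq show ?thesis by simp
  qed (use assms in auto)
qed

lemma chamber_convex:
  assumes "a \<in> chamber I W s" "b \<in> chamber I W s" "0 \<le> t" "t \<le> 1"
  shows "(\<lambda>i. a i + t * (b i - a i)) \<in> chamber I W s"
  using assms by (simp add: chamber_def lin_add lin_cmult lin_diff sgn_convex_combination)

lemma chamber_open:
  assumes "finite W" "finite I" "\<And>l. l \<in> W \<Longrightarrow> s l \<noteq> 0" "a \<in> chamber I W s"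
  shows "\<exists>e>0. \<forall>b. (\<forall>i\<in>I. \<bar>b i - a i\<bar> < e) \<longrightarrow> b \<in> chamber I W s"
  using assms
proof (induction W rule: finite_induct)
  case empty
  show ?case by (auto simp: chamber_def intro: exI[of _ 1])
next
  case (insert l W)
  then obtain e where e: "e > 0" "\<And>b. (\<forall>i\<in>I. \<bar>b i - a i\<bar> < e) \<Longrightarrow> b \<in> chamber I W s"
    by (auto simp: chamber_def)
  define m where "m = (\<Sum>i\<in>I. \<bar>real_of_int (l i)\<bar>)"
  have "m \<ge> 0" by (simp add: m_def sum_nonneg)
  have sl: "sgn (lin I l a) = s l" "s l \<noteq> 0" using insert.prems by (auto simp: chamber_def)
  then have pos: "\<bar>lin I l a\<bar> > 0" by auto
  define e' where "e' = min e (\<bar>lin I l a\<bar> / (m + 1))"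
  have "e' > 0" using e pos \<open>m \<ge> 0\<close> by (simp add: e'_def)
  have "sgn (lin I l b) = s l" if "\<forall>i\<in>I. \<bar>b i - a i\<bar> < e'" for b
  proof -
    have le: "\<bar>b i - a i\<bar> \<le> e'" if "i \<in> I" for i
      using \<open>\<forall>i\<in>I. \<bar>b i - a i\<bar> < e'\<close> that by (auto intro: less_imp_le)
    have "\<bar>lin I l b - lin I l a\<bar> = \<bar>lin I l (\<lambda>i. b i - a i)\<bar>" by (simp add: lin_diff)
    also have "\<dots> \<le> (\<Sum>i\<in>I. \<bar>real_of_int (l i)\<bar> * e')"
      unfolding lin_def
      by (intro order_trans[OF sum_abs] sum_mono) (auto simp: abs_mult intro!: mult_left_mono le)
    also have "\<dots> = m * e'" by (simp add: m_def sum_distrib_right)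
    also have "\<dots> < (m + 1) * e'" using \<open>e' > 0\<close> by simp
    also have "\<dots> \<le> (m + 1) * (\<bar>lin I l a\<bar> / (m + 1))"
      using \<open>m \<ge> 0\<close> by (intro mult_left_mono) (auto simp: e'_def)
    also have "\<dots> = \<bar>lin I l a\<bar>" using \<open>m \<ge> 0\<close> by simp
    finally show ?thesis using sl by (auto simp: sgn_if split: if_splits)
  qed
  then show ?case using \<open>e' > 0\<close> e(2)
    by (intro exI[of _ e']) (auto simp: chamber_def e'_def)
qed

text \<open>
  An open cone that contains a small box around one point contains large multiples of this box, and
  these contain boxes of integer points of any given side.
\<close>

lemma chamber_contains_box:
  assumes "finite W" "finite I" "\<And>l. l \<in> W \<Longrightarrow> s l \<noteq> 0" "a \<in> chamber I W s"
  obtains z0 :: "'i \<Rightarrow> int"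
  where "\<And>z. (\<And>i. i \<in> I \<Longrightarrow> z0 i \<le> z i \<and> z i \<le> z0 i + int M) \<Longrightarrow> (\<lambda>i. of_int (z i)) \<in> chamber I W s"
proof -
  obtain e where e: "e > 0" "\<And>b. (\<forall>i\<in>I. \<bar>b i - a i\<bar> < e) \<Longrightarrow> b \<in> chamber I W s"
    using chamber_open[of W I s a] assms by auto
  define N where "N = (real M + 2) / e"
  have "N > 0" "N * e = real M + 2" using e by (auto simp: N_def)
  define z0 where "z0 = (\<lambda>i. \<lceil>N * a i\<rceil>)"
  have "(\<lambda>i. of_int (z i)) \<in> chamber I W s"
    if z: "\<And>i. i \<in> I \<Longrightarrow> z0 i \<le> z i \<and> z i \<le> z0 i + int M" for z
  proof -
    have "(\<lambda>i. of_int (z i) / N) \<in> chamber I W s"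
    proof (rule e(2), intro ballI)
      fix i assume "i \<in> I"
      have "\<bar>of_int (z i) - N * a i\<bar> < real M + 2"
        using z[OF \<open>i \<in> I\<close>] unfolding z0_def by linarith
      then have "\<bar>of_int (z i) - N * a i\<bar> / N < e"
        using \<open>N > 0\<close> \<open>N * e = real M + 2\<close> by (simp add: field_simps)
      moreover have "\<bar>of_int (z i) / N - a i\<bar> = \<bar>of_int (z i) - N * a i\<bar> / N"
        using \<open>N > 0\<close> by (subst abs_div_pos) (auto simp: field_simps)
      ultimately show "\<bar>of_int (z i) / N - a i\<bar> < e" by simp
    qed
    from chamber_scale[OF this \<open>N > 0\<close>] show ?thesis using \<open>N > 0\<close> by simp
  qed
  with that show thesis by blast
qed

text \<open>
  The function \<open>G\<close> is seen as a function of a real vector \<open>a\<close> that is constant as long as no coordinate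
  crosses an integer; the hypothesis describes the jump at each crossing inside the chamber. On a large
  box of integer points the jumps can be summed to a polynomial \<open>P\<close>, and then \<open>P\<close> has the same
  jumps as \<open>G\<close> in the whole chamber. Since a chamber is connected and the difference
  of the two functions is locally constant, they agree everywhere in it. A narrow chamber need not
  connect its integer points by unit steps; this is why the bounds are real numbers.
\<close>

lemma polynomial_on_chamber_if_differences_polynomial:
  fixes G :: "('i \<Rightarrow> int) \<Rightarrow> rat"
  assumes finW: "finite W" and finI: "finite I" and s: "\<And>l. l \<in> W \<Longrightarrow> s l \<noteq> 0"
    and G_cong: "\<And>z z'. (\<And>i. i \<in> I \<Longrightarrow> z i = z' i) \<Longrightarrow> G z = G z'"
    and diff: "\<And>i. i \<in> I \<Longrightarrow> \<exists>d Q. polyfn I d Q \<and>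
        (\<forall>a\<in>chamber I W s. \<forall>n. a i = of_int n \<longrightarrow>
           G ((\<lambda>j. \<lceil>a j\<rceil>)(i := n + 1)) - G (\<lambda>j. \<lceil>a j\<rceil>) = Q (\<lambda>j. of_int \<lceil>a j\<rceil>))"
  shows "\<exists>d P. polyfn I d P \<and> (\<forall>a\<in>chamber I W s. G (\<lambda>j. \<lceil>a j\<rceil>) = P (\<lambda>j. of_int \<lceil>a j\<rceil>))"
proof (cases "chamber I W s = {}")
  case True
  then show ?thesis using polyfn.const by blast
next
  case False
  define C where "C = chamber I W s"
  obtain a0 where a0: "a0 \<in> C" using False by (auto simp: C_def)
  obtain d Q where dQ: "\<And>i. i \<in> I \<Longrightarrow> polyfn I (d i) (Q i)"
    and Q: "\<And>i a n. i \<in> I \<Longrightarrow> a \<in> C \<Longrightarrow> a i = of_int n \<Longrightarrow>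
           G ((\<lambda>j. \<lceil>a j\<rceil>)(i := n + 1)) - G (\<lambda>j. \<lceil>a j\<rceil>) = Q i (\<lambda>j. of_int \<lceil>a j\<rceil>)"
    using diff unfolding C_def by metis
  define D where "D = (\<Sum>i\<in>I. d i)"
  have polyQ: "polyfn I D (Q i)" if "i \<in> I" for i
    using dQ[OF that] by (rule polyfn_mono) (simp add: D_def member_le_sum finI that)
  have "\<exists>R. polyfn I (Suc D) R \<and> (\<forall>x. R (x(i := x i + 1)) - R x = Q i x)" if "i \<in> I" for i
    using polyfn_antidifference[OF polyQ[OF that] that] by metis
  then obtain R where polyR: "\<And>i. i \<in> I \<Longrightarrow> polyfn I (Suc D) (R i)"
    and R: "\<And>i x. i \<in> I \<Longrightarrow> R i (x(i := x i + 1)) - R i x = Q i x"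
    by metis
  \<comment> \<open>A polynomial of degree at most \<open>D + 1\<close> is determined by its values on a box of side \<open>D + 1\<close>; one more layer leaves room for a difference.\<close>
  define M where "M = D + 2"
  obtain z0 where z0: "\<And>z. (\<And>i. i \<in> I \<Longrightarrow> z0 i \<le> z i \<and> z i \<le> z0 i + int M) \<Longrightarrow>
      (\<lambda>i. of_int (z i)) \<in> C"
    using chamber_contains_box[OF finW finI s a0[unfolded C_def]] unfolding C_def by metis
  define box where "box = {z. \<forall>i\<in>I. z0 i \<le> z i \<and> z i \<le> z0 i + int M}"
  have boxC: "(\<lambda>i. of_int (z i)) \<in> C" if "z \<in> box" for z
    using z0 that by (auto simp: box_def)
  have Qbox: "G (z(i := z i + 1)) - G z = Q i (\<lambda>j. of_int (z j))" if "z \<in> box" "i \<in> I" for z i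
    using Q[OF that(2) boxC[OF that(1)], of "z i"] by simp
  have "\<exists>P. polyfn I (Suc D) P \<and>
     (\<forall>z\<in>box. (\<forall>i\<in>I - K. z i = z0 i) \<longrightarrow> G z = P (\<lambda>j. of_int (z j)))"
    if "K \<subseteq> I" for K
    using finite_subset[OF that finI] that
  proof (induction K rule: finite_induct)
    case empty
    show ?case
      by (intro exI[of _ "\<lambda>_. G z0"]) (auto intro: polyfn.const G_cong)
  next
    case (insert i K)
    then have "i \<in> I" by simp
    obtain P where P: "polyfn I (Suc D) P"
      "\<And>z. z \<in> box \<Longrightarrow> (\<And>i. i \<in> I - K \<Longrightarrow> z i = z0 i) \<Longrightarrow> G z = P (\<lambda>j. of_int (z j))"
      using insert by blast
    \<comment> \<open>Sum the differences along direction \<open>i\<close>, starting from the face \<open>z i = z0 i\<close>, where \<open>P\<close> is already known.\<close>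
    define P' where "P' = (\<lambda>x. P (x(i := of_int (z0 i))) + (R i x - R i (x(i := of_int (z0 i)))))"
    have "polyfn I (Suc D) P'"
      unfolding P'_def by (intro polyfn.add polyfn_diff polyfn_upd P polyR \<open>i \<in> I\<close>)
    moreover have "G z = P' (\<lambda>j. of_int (z j))"
      if z: "z \<in> box" "\<And>j. j \<in> I - insert i K \<Longrightarrow> z j = z0 j" for z
    proof -
      have inbox: "z(i := z0 i + int n) \<in> box" if "n \<le> M" for n
        using z(1) that by (auto simp: box_def)
      let ?x = "\<lambda>n j. rat_of_int ((z(i := z0 i + int n)) j)"
      have tele: "G (z(i := z0 i + int n)) = G (z(i := z0 i)) + (R i (?x n) - R i (?x 0))"
        if "n \<le> M" for n
        using that
      proof (induction n)
        case (Suc n)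
        have "G (z(i := z0 i + int (Suc n))) - G (z(i := z0 i + int n)) = Q i (?x n)"
          using Qbox[OF inbox \<open>i \<in> I\<close>, of n] Suc.prems by (simp add: algebra_simps)
        also have "\<dots> = R i ((?x n)(i := ?x n i + 1)) - R i (?x n)"
          by (rule R[OF \<open>i \<in> I\<close>, symmetric])
        also have "(?x n)(i := ?x n i + 1) = ?x (Suc n)" by (auto simp: fun_eq_iff)
        finally show ?case using Suc by simp
      qed simp
      define n where "n = nat (z i - z0 i)"
      have n: "n \<le> M" "z0 i + int n = z i"
        using z(1) \<open>i \<in> I\<close> by (auto simp: box_def n_def)
      have "G (z(i := z0 i)) = P (?x 0)"
        using P(2)[OF inbox[of 0]] z(2) by auto
      moreover have "?x 0 = (\<lambda>j. of_int (z j))(i := of_int (z0 i))" by (auto simp: fun_eq_iff)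
      moreover have "?x n = (\<lambda>j. of_int (z j))" using n by (auto simp: fun_eq_iff)
      moreover have "z(i := z0 i + int n) = z" using n by (auto simp: fun_eq_iff)
      ultimately show ?thesis using tele[OF n(1)] by (simp add: P'_def)
    qed
    ultimately show ?case by blast
  qed
  from this[of I] obtain P where P: "polyfn I (Suc D) P"
    and GP: "\<And>z. z \<in> box \<Longrightarrow> G z = P (\<lambda>j. of_int (z j))" by auto
  \<comment> \<open>\<open>P\<close> depends on the order in which the directions were treated, yet on the box every difference of \<open>P\<close> is one of \<open>G\<close>; the box is large enough to turn this into an identity of polynomials.\<close>
  have PQ: "P (x(i := x i + 1)) - P x = Q i x" if "i \<in> I" for i x
  proof -
    define f where "f = (\<lambda>x. (P (x(i := x i + 1)) - P x) - Q i x)"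
    have f: "polyfn I (Suc D) f" unfolding f_def
      by (intro polyfn_diff P polyfn_shift polyfn_mono[OF polyQ[OF that]]) simp
    have "f x = 0"
    proof (rule polyfn_eq_0_if_grid[OF f finI, where T = "\<lambda>i. of_int ` {z0 i..z0 i + int (Suc D)}"])
      fix j assume "j \<in> I"
      have "card (rat_of_int ` {z0 j..z0 j + int (Suc D)}) = Suc (Suc D)"
        by (subst card_image) (auto simp: inj_on_def)
      then show "finite (rat_of_int ` {z0 j..z0 j + int (Suc D)}) \<and>
          Suc D < card (rat_of_int ` {z0 j..z0 j + int (Suc D)})" by simp
    next
      fix x assume "\<And>i. i \<in> I \<Longrightarrow> x i \<in> rat_of_int ` {z0 i..z0 i + int (Suc D)}"
      then have "\<forall>i\<in>I. \<exists>z. x i = of_int z \<and> z0 i \<le> z \<and> z \<le> z0 i + int (Suc D)" by force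
      then obtain z where z: "\<And>i. i \<in> I \<Longrightarrow> x i = of_int (z i) \<and> z0 i \<le> z i \<and> z i \<le> z0 i + int (Suc D)"
        by metis
      then have zbox: "z \<in> box" "z(i := z i + 1) \<in> box" by (force simp: box_def M_def)+
      have "(\<lambda>j. rat_of_int ((z(i := z i + 1)) j)) = (\<lambda>j. of_int (z j))(i := of_int (z i) + 1)"
        by (auto simp: fun_eq_iff)
      then have "f (\<lambda>j. of_int (z j)) = 0"
        using Qbox[OF zbox(1) that] GP[OF zbox(1)] GP[OF zbox(2)] by (simp add: f_def)
      also have "f (\<lambda>j. of_int (z j)) = f x"
        by (rule polyfn_cong_vars[OF f]) (use z in auto)
      finally show "f x = 0" .
    qed
    then show ?thesis by (simp add: f_def)
  qed
  \<comment> \<open>From here on \<open>P\<close> has to be compared with \<open>G\<close> away from the box.\<close>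
  define h where "h = (\<lambda>a :: 'i \<Rightarrow> real. G (\<lambda>j. \<lceil>a j\<rceil>) - P (\<lambda>j. of_int \<lceil>a j\<rceil>))"
  have h_cong: "h a = h b" if "\<And>i. i \<in> I \<Longrightarrow> a i = b i" for a b
  proof -
    have "G (\<lambda>j. \<lceil>a j\<rceil>) = G (\<lambda>j. \<lceil>b j\<rceil>)" by (rule G_cong) (simp add: that)
    moreover have "P (\<lambda>j. of_int \<lceil>a j\<rceil>) = P (\<lambda>j. of_int \<lceil>b j\<rceil>)"
      by (rule polyfn_cong_vars[OF P]) (simp add: that)
    ultimately show ?thesis by (simp add: h_def)
  qed
  have up: "h (a(i := t)) = h a"
    if a: "a \<in> C" "a(i := t) \<in> C" "i \<in> I" "a i \<le> t" "t \<le> a i + 1" for a i t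
  proof (cases "\<lceil>t\<rceil> = \<lceil>a i\<rceil>")
    case True
    then have eq: "\<lceil>(a(i := t)) j\<rceil> = \<lceil>a j\<rceil>" for j by auto
    show ?thesis unfolding h_def eq ..
  next
    case False
    define n where "n = \<lceil>a i\<rceil>"
    have n: "\<lceil>t\<rceil> = n + 1" "a i \<le> of_int n" "of_int n < t"
      using False a(4,5) unfolding n_def by linarith+
    \<comment> \<open>The segment from \<open>a\<close> to its end point crosses the integer level \<open>n\<close> once, at a point that lies in the chamber by convexity.\<close>
    define r where "r = (of_int n - a i) / (t - a i)"
    have "0 \<le> r" "r \<le> 1" "r * (t - a i) = of_int n - a i" using n by (auto simp: r_def)
    then have "(\<lambda>j. a j + r * ((a(i := t)) j - a j)) \<in> C"
      using chamber_convex a(1,2) unfolding C_def by blast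
    also have "(\<lambda>j. a j + r * ((a(i := t)) j - a j)) = a(i := of_int n)"
      using \<open>r * (t - a i) = of_int n - a i\<close> by (auto simp: fun_eq_iff)
    finally have b: "a(i := of_int n) \<in> C" .
    have ceq: "\<lceil>(a(i := of_int n)) j\<rceil> = \<lceil>a j\<rceil>" for j by (auto simp: n_def)
    have teq: "\<lceil>(a(i := t)) j\<rceil> = ((\<lambda>j. \<lceil>a j\<rceil>)(i := n + 1)) j" for j by (auto simp: n)
    have ueq: "(\<lambda>j. rat_of_int (((\<lambda>j. \<lceil>a j\<rceil>)(i := n + 1)) j)) =
        (\<lambda>j. of_int \<lceil>a j\<rceil>)(i := of_int \<lceil>a i\<rceil> + 1)"
      by (auto simp: fun_eq_iff n_def)
    have "G ((\<lambda>j. \<lceil>a j\<rceil>)(i := n + 1)) - G (\<lambda>j. \<lceil>a j\<rceil>) = Q i (\<lambda>j. of_int \<lceil>a j\<rceil>)"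
      using Q[OF a(3) b fun_upd_same] unfolding ceq .
    also have "\<dots> = P (\<lambda>j. of_int (((\<lambda>j. \<lceil>a j\<rceil>)(i := n + 1)) j)) - P (\<lambda>j. of_int \<lceil>a j\<rceil>)"
      unfolding ueq by (rule PQ[OF a(3), symmetric])
    finally show ?thesis unfolding h_def teq by (simp add: algebra_simps fun_upd_def)
  qed
  have move: "h (a(i := t)) = h a"
    if a: "a \<in> C" "a(i := t) \<in> C" "i \<in> I" "\<bar>t - a i\<bar> \<le> 1" for a i t
  proof (cases "a i \<le> t")
    case True
    then show ?thesis using up a by auto
  next
    case False
    then show ?thesis using up[of "a(i := t)" i "a i"] a by auto
  qed
  \<comment> \<open>Small displacements are made one coordinate at a time, so that each of them is a move as above.\<close>
  have local: "\<exists>e>0. \<forall>b. (\<forall>i\<in>I. \<bar>b i - a i\<bar> < e) \<longrightarrow> h b = h a" if a: "a \<in> C" for a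
  proof -
    obtain e where e: "e > 0" "\<And>b. (\<forall>i\<in>I. \<bar>b i - a i\<bar> < e) \<Longrightarrow> b \<in> C"
      using chamber_open[of W I s a, OF finW finI] s a unfolding C_def by metis
    have "h b = h a" if b: "\<forall>i\<in>I. \<bar>b i - a i\<bar> < min e 1" for b
    proof -
      have inC: "(\<lambda>j. if j \<in> K then b j else a j) \<in> C" for K
        using b e by (intro e(2)) auto
      have "h (\<lambda>j. if j \<in> K then b j else a j) = h a" if "K \<subseteq> I" for K
        using finite_subset[OF that finI] that
      proof (induction K rule: finite_induct)
        case (insert i K)
        have eq: "(\<lambda>j. if j \<in> insert i K then b j else a j) = (\<lambda>j. if j \<in> K then b j else a j)(i := b i)"
          by auto
        have "h (\<lambda>j. if j \<in> insert i K then b j else a j) = h (\<lambda>j. if j \<in> K then b j else a j)"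
          unfolding eq
        proof (rule move)
          show "(\<lambda>j. if j \<in> K then b j else a j)(i := b i) \<in> C" using inC[of "insert i K"] unfolding eq .
          show "\<bar>b i - (if i \<in> K then b i else a i)\<bar> \<le> 1" using b insert by auto
        qed (use inC insert in auto)
        then show ?case using insert by simp
      qed simp
      from this[of I] have "h (\<lambda>j. if j \<in> I then b j else a j) = h a" by simp
      moreover have "h (\<lambda>j. if j \<in> I then b j else a j) = h b" by (rule h_cong) simp
      ultimately show ?thesis by simp
    qed
    moreover have "min e 1 > 0" using \<open>e > 0\<close> by simp
    ultimately show ?thesis by blast
  qed
  have const: "h a = h b" if a: "a \<in> C" and b: "b \<in> C" for a b
  proof -
    define g where "g = (\<lambda>t. (\<lambda>i. a i + t * (b i - a i)))"
    have "h (g 0) = h (g 1)"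
    proof (rule connected_local_const[of "{0..1::real}"])
      show "\<forall>t\<in>{0..1}. \<forall>\<^sub>F u in at t within {0..1}. h (g t) = h (g u)"
      proof
        fix t :: real assume t: "t \<in> {0..1}"
        have "g t \<in> C" unfolding g_def C_def
          by (rule chamber_convex) (use a b t in \<open>auto simp: C_def\<close>)
        from local[OF this] obtain e where e: "e > 0" "\<And>c. (\<forall>i\<in>I. \<bar>c i - g t i\<bar> < e) \<Longrightarrow> h c = h (g t)"
          by blast
        define m where "m = (\<Sum>i\<in>I. \<bar>b i - a i\<bar>)"
        have "m \<ge> 0" by (auto simp: m_def sum_nonneg)
        have "h (g t) = h (g u)" if u: "dist u t < e / (m + 1)" for u
        proof (rule e(2)[symmetric], intro ballI)
          fix i assume "i \<in> I"
          have "g u i - g t i = (u - t) * (b i - a i)" by (simp add: g_def algebra_simps)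
          then have "\<bar>g u i - g t i\<bar> = dist u t * \<bar>b i - a i\<bar>" by (simp add: dist_real_def abs_mult)
          also have "\<dots> \<le> dist u t * m"
            using \<open>i \<in> I\<close> finI by (intro mult_left_mono) (auto simp: m_def intro: member_le_sum)
          also have "\<dots> \<le> dist u t * (m + 1)" by (intro mult_left_mono) auto
          also have "\<dots> < e / (m + 1) * (m + 1)" using u \<open>m \<ge> 0\<close> by (intro mult_strict_right_mono) auto
          also have "\<dots> = e" using \<open>m \<ge> 0\<close> by simp
          finally show "\<bar>g u i - g t i\<bar> < e" .
        qed
        then show "\<forall>\<^sub>F u in at t within {0..1}. h (g t) = h (g u)"
          unfolding eventually_at using e(1) \<open>m \<ge> 0\<close>
          by (intro exI[of _ "e / (m + 1)"]) auto
      qed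
    qed auto
    then show ?thesis by (simp add: g_def)
  qed
  have "z0 \<in> box" by (simp add: box_def)
  then have "h (\<lambda>i. of_int (z0 i)) = 0" using GP by (simp add: h_def)
  then have "h a = 0" if "a \<in> C" for a using const[OF that boxC[OF \<open>z0 \<in> box\<close>]] by simp
  then show ?thesis using P unfolding h_def C_def by auto
qed

section \<open>Counting points of a unimodular lattice under upper bounds\<close>

text \<open>
  A group of integer vectors such that every coordinate that is not identically zero on a coordinate
  subgroup takes the value one there. This form of unimodularity is inherited by the subgroups
  \<open>x i = 0\<close>, which is what an induction on the number of coordinates needs. Boundedness says
  that upper bounds on all the coordinates leave only finitely many vectors.
\<close>

locale unimodular_lattice =
  fixes I :: "'i set" and L :: "('i \<Rightarrow> int) set"
  assumes finite_I: "finite I"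
    and diff_closed: "x \<in> L \<Longrightarrow> y \<in> L \<Longrightarrow> (\<lambda>i. x i - y i) \<in> L"
    and unimodular: "J \<subseteq> I \<Longrightarrow> i \<in> I \<Longrightarrow>
      (\<forall>x\<in>L. (\<forall>j\<in>J. x j = 0) \<longrightarrow> x i = 0) \<or> (\<exists>c\<in>L. (\<forall>j\<in>J. c j = 0) \<and> c i = 1)"
    and bounded: "finite {x \<in> L. \<forall>i\<in>I. x i < b i}"
begin

lemma add_closed:
  assumes "x \<in> L" "y \<in> L" shows "(\<lambda>i. x i + y i) \<in> L"
proof -
  have "(\<lambda>i. y i - y i) \<in> L" by (intro diff_closed assms)
  then have "(\<lambda>i. (y i - y i) - y i) \<in> L" by (rule diff_closed) fact
  then have "(\<lambda>i. x i - ((y i - y i) - y i)) \<in> L" by (rule diff_closed[OF assms(1)])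
  then show ?thesis by simp
qed

lemma scale_closed:
  assumes "x \<in> L" shows "(\<lambda>i. n * x i) \<in> L"
proof -
  have z: "(\<lambda>i. 0) \<in> L" using diff_closed[OF assms assms] by simp
  have nat: "(\<lambda>i. int m * x i) \<in> L" for m
  proof (induction m)
    case (Suc m)
    then show ?case using add_closed[OF Suc assms] by (simp add: algebra_simps)
  qed (use z in simp)
  show ?thesis
  proof (cases n)
    case (nonneg m)
    then show ?thesis using nat by simp
  next
    case (neg m)
    have "(\<lambda>i. 0 - int (Suc m) * x i) \<in> L" by (rule diff_closed[OF z nat])
    also have "(\<lambda>i. 0 - int (Suc m) * x i) = (\<lambda>i. n * x i)" by (simp only: neg mult_minus_left diff_0)
    finally show ?thesis .
  qed
qed

text \<open>
  The coordinates in \<open>J\<close> have already been set to zero and carry no bound any more.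
\<close>

definition points :: "'i set \<Rightarrow> ('i \<Rightarrow> int) \<Rightarrow> ('i \<Rightarrow> int) set" where
  "points J z = {x \<in> L. (\<forall>j\<in>J. x j = 0) \<and> (\<forall>i\<in>I - J. x i < z i)}"

lemma finite_points: "finite (points J z)"
  by (rule finite_subset[OF _ bounded[of "\<lambda>i. if i \<in> J then 1 else z i"]])
    (auto simp: points_def)

text \<open>
  The new points lie on the slice \<open>x i = z i\<close>. Subtracting \<open>z i * c\<close> moves this slice to the
  subgroup \<open>x i = 0\<close>, and the bounds move along with it.
\<close>

lemma card_points_raise_bound:
  assumes i: "i \<in> I - J" and c: "c \<in> L" "\<forall>j\<in>J. c j = 0" "c i = 1"
  shows "card (points J (z(i := z i + 1))) =
    card (points J z) + card (points (insert i J) (\<lambda>j. z j - z i * c j))"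
proof -
  let ?B = "{x \<in> points J (z(i := z i + 1)). x i = z i}"
  let ?g = "\<lambda>x j. x j + z i * c j"
  have sc: "(\<lambda>j. z i * c j) \<in> L" by (rule scale_closed[OF c(1)])
  have "points J (z(i := z i + 1)) = points J z \<union> ?B" "points J z \<inter> ?B = {}"
    using i by (force simp: points_def)+
  then have "card (points J (z(i := z i + 1))) = card (points J z) + card ?B"
    using card_Un_disjoint[of "points J z" ?B] finite_points by auto
  moreover have "bij_betw ?g (points (insert i J) (\<lambda>j. z j - z i * c j)) ?B"
  proof (rule bij_betw_byWitness[where f' = "\<lambda>x j. x j - z i * c j"])
    show "?g ` points (insert i J) (\<lambda>j. z j - z i * c j) \<subseteq> ?B"
    proof
      fix y assume "y \<in> ?g ` points (insert i J) (\<lambda>j. z j - z i * c j)"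
      then obtain x where x: "x \<in> points (insert i J) (\<lambda>j. z j - z i * c j)" "y = ?g x" by auto
      show "y \<in> ?B"
        using x add_closed[OF _ sc, of x] c i by (force simp: points_def)
    qed
    show "(\<lambda>x j. x j - z i * c j) ` ?B \<subseteq> points (insert i J) (\<lambda>j. z j - z i * c j)"
      using diff_closed[OF _ sc] c i by (auto simp: points_def)
  qed auto
  then have "card (points (insert i J) (\<lambda>j. z j - z i * c j)) = card ?B"
    by (rule bij_betw_same_card)
  ultimately show ?thesis by simp
qed

text \<open>
  Where coordinate \<open>i\<close> vanishes identically its bound is either vacuous or unsatisfiable, and only the
  passage from bound 0 to bound 1 makes a difference.
\<close>

lemma points_raise_bound_loop:
  assumes i: "i \<in> I" and loop: "\<forall>x\<in>L. (\<forall>j\<in>J. x j = 0) \<longrightarrow> x i = 0" and "z i \<noteq> 0"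
  shows "points J (z(i := z i + 1)) = points J z"
  using assms by (force simp: points_def)

text \<open>
  Raising a bound changes the count by a count for a smaller problem, whose bounds
  depend linearly on the old ones and, because \<open>c\<close> is integral, commute with rounding up. By induction
  these changes are polynomial away from the pulled back walls. All walls are nonzero
  functionals, so that generic bounds avoid them; the conclusion about \<open>I - J\<close> is what makes
  this survive the pullback, which alters only the coefficient at \<open>i\<close>.
\<close>

lemma points_chamberwise_polynomial:
  assumes "J \<subseteq> I"
  shows "\<exists>W. finite W \<and> (\<forall>l\<in>W. \<exists>i\<in>I - J. l i \<noteq> 0) \<and>
    (\<forall>s. (\<forall>l\<in>W. s l \<noteq> 0) \<longrightarrow> (\<exists>d P. polyfn I d P \<and>
      (\<forall>a\<in>chamber I W s. of_nat (card (points J (\<lambda>i. \<lceil>a i\<rceil>))) = P (\<lambda>i. of_int \<lceil>a i\<rceil>))))"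
  using assms
proof (induction "card (I - J)" arbitrary: J rule: less_induct)
  case less
  define good where "good = (\<lambda>i c U. finite U \<and> (\<forall>l\<in>U. \<exists>j\<in>I - J. l j \<noteq> 0) \<and>
     ((\<forall>x\<in>L. (\<forall>j\<in>J. x j = 0) \<longrightarrow> x i = 0) \<and> U = {(\<lambda>j. if j = i then 1 else 0)} \<or>
      c \<in> L \<and> (\<forall>j\<in>J. c j = 0) \<and> c i = 1 \<and>
      (\<forall>s. (\<forall>l\<in>U. s l \<noteq> 0) \<longrightarrow> (\<exists>d P. polyfn I d P \<and>
        (\<forall>a\<in>chamber I U s.
           of_nat (card (points (insert i J) (\<lambda>j. \<lceil>a j - a i * of_int (c j)\<rceil>)))
             = P (\<lambda>j. of_int \<lceil>a j - a i * of_int (c j)\<rceil>))))))"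
  have "\<exists>c U. good i c U" if i: "i \<in> I - J" for i
  proof (cases "\<forall>x\<in>L. (\<forall>j\<in>J. x j = 0) \<longrightarrow> x i = 0")
    case True
    with i show ?thesis unfolding good_def by (intro exI[of _ "\<lambda>_. 0"] exI[of _ "{(\<lambda>j. if j = i then 1 else 0)}"]) auto
  next
    case False
    then obtain c where c: "c \<in> L" "\<forall>j\<in>J. c j = 0" "c i = 1"
      using unimodular[of J i] less.prems i by blast
    have "card (I - insert i J) < card (I - J)"
      using i finite_I by (intro psubset_card_mono) auto
    with less.hyps[of "insert i J"] less.prems i obtain W where W: "finite W"
      "\<And>l. l \<in> W \<Longrightarrow> \<exists>j\<in>I - insert i J. l j \<noteq> 0"
      "\<And>s. (\<forall>l\<in>W. s l \<noteq> 0) \<Longrightarrow> \<exists>d P. polyfn I d P \<and>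
        (\<forall>a\<in>chamber I W s. of_nat (card (points (insert i J) (\<lambda>i. \<lceil>a i\<rceil>))) = P (\<lambda>i. of_int \<lceil>a i\<rceil>))"
      by auto
    \<comment> \<open>\<open>pb l\<close> is the pullback of the functional \<open>l\<close> along the linear map that sends \<open>a\<close> to \<open>a - a i * c\<close>; it agrees with \<open>l\<close> outside \<open>i\<close> and therefore is nonzero again.\<close>
    define pb where "pb = (\<lambda>l::'i \<Rightarrow> int. l(i := l i - (\<Sum>j\<in>I. l j * c j)))"
    have pb: "lin I (pb l) a = lin I l (\<lambda>j. a j - a i * of_int (c j))" for l a
    proof -
      have "lin I (pb l) a = (\<Sum>j\<in>I. of_int (l j) * a j - (if j = i then of_int (\<Sum>j\<in>I. l j * c j) * a j else 0))"
        unfolding lin_def pb_def by (rule sum.cong) (auto simp: algebra_simps)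
      also have "\<dots> = lin I l a - of_int (\<Sum>j\<in>I. l j * c j) * a i"
        using i finite_I by (simp add: sum_subtractf lin_def)
      also have "\<dots> = lin I l (\<lambda>j. a j - a i * of_int (c j))"
        unfolding lin_diff by (simp add: lin_def sum_distrib_left sum_distrib_right mult_ac)
      finally show ?thesis .
    qed
    show ?thesis unfolding good_def
    proof (intro exI[of _ c] exI[of _ "pb ` W"] conjI disjI2 allI impI)
      show "\<forall>l\<in>pb ` W. \<exists>j\<in>I - J. l j \<noteq> 0"
      proof
        fix l assume "l \<in> pb ` W"
        then obtain l' where "l' \<in> W" "l = pb l'" by auto
        with W(2)[of l'] show "\<exists>j\<in>I - J. l j \<noteq> 0" by (auto simp: pb_def)
      qed
      fix s :: "('i \<Rightarrow> int) \<Rightarrow> real" assume s: "\<forall>l\<in>pb ` W. s l \<noteq> 0"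
      then obtain d P where P: "polyfn I d P"
        "\<And>a. a \<in> chamber I W (\<lambda>l. s (pb l)) \<Longrightarrow>
           of_nat (card (points (insert i J) (\<lambda>i. \<lceil>a i\<rceil>))) = P (\<lambda>i. of_int \<lceil>a i\<rceil>)"
        using W(3)[of "\<lambda>l. s (pb l)"] by auto
      show "\<exists>d P. polyfn I d P \<and> (\<forall>a\<in>chamber I (pb ` W) s.
           of_nat (card (points (insert i J) (\<lambda>j. \<lceil>a j - a i * of_int (c j)\<rceil>)))
             = P (\<lambda>j. of_int \<lceil>a j - a i * of_int (c j)\<rceil>))"
      proof (intro exI conjI ballI)
        show "polyfn I d P" by fact
        fix a assume "a \<in> chamber I (pb ` W) s"
        then have "(\<lambda>j. a j - a i * of_int (c j)) \<in> chamber I W (\<lambda>l. s (pb l))"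
          by (auto simp: chamber_def pb)
        then show "of_nat (card (points (insert i J) (\<lambda>j. \<lceil>a j - a i * of_int (c j)\<rceil>)))
             = P (\<lambda>j. of_int \<lceil>a j - a i * of_int (c j)\<rceil>)"
          by (rule P(2))
      qed
    qed (use W c in auto)
  qed
  then obtain c U where good: "\<And>i. i \<in> I - J \<Longrightarrow> good i (c i) (U i)" by metis
  note U = good[unfolded good_def, THEN conjunct1] good[unfolded good_def, THEN conjunct2, THEN conjunct1]
    good[unfolded good_def, THEN conjunct2, THEN conjunct2]
  define W where "W = (\<Union>i\<in>I - J. U i)"
  have finW: "finite W" using U(1) finite_I by (auto simp: W_def)
  show ?case
  proof (intro exI[of _ W] conjI allI impI)
    show "finite W" by fact
    show "\<forall>l\<in>W. \<exists>i\<in>I - J. l i \<noteq> 0" using U(2) by (auto simp: W_def)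
    fix s :: "('i \<Rightarrow> int) \<Rightarrow> real" assume s: "\<forall>l\<in>W. s l \<noteq> 0"
    show "\<exists>d P. polyfn I d P \<and>
      (\<forall>a\<in>chamber I W s. of_nat (card (points J (\<lambda>i. \<lceil>a i\<rceil>))) = P (\<lambda>i. of_int \<lceil>a i\<rceil>))"
    proof (rule polynomial_on_chamber_if_differences_polynomial[OF finW finite_I])
      show "s l \<noteq> 0" if "l \<in> W" for l using s that by blast
      show "of_nat (card (points J z)) = of_nat (card (points J z'))"
        if "\<And>i. i \<in> I \<Longrightarrow> z i = z' i" for z z'
        using that by (simp add: points_def)
      fix i assume iI: "i \<in> I"
      let ?goal = "\<lambda>Q. \<forall>a\<in>chamber I W s. \<forall>n. a i = real_of_int n \<longrightarrow>
         rat_of_nat (card (points J ((\<lambda>j. \<lceil>a j\<rceil>)(i := n + 1)))) -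
         of_nat (card (points J (\<lambda>j. \<lceil>a j\<rceil>))) = Q (\<lambda>j. of_int \<lceil>a j\<rceil>)"
      consider "i \<in> J" | "i \<in> I - J" "\<forall>x\<in>L. (\<forall>j\<in>J. x j = 0) \<longrightarrow> x i = 0" "U i = {(\<lambda>j. if j = i then 1 else 0)}"
        | "i \<in> I - J" "c i \<in> L" "\<forall>j\<in>J. c i j = 0" "c i i = 1"
          "\<exists>d P. polyfn I d P \<and>
            (\<forall>a\<in>chamber I (U i) s.
              of_nat (card (points (insert i J) (\<lambda>j. \<lceil>a j - a i * of_int (c i j)\<rceil>)))
             = P (\<lambda>j. of_int \<lceil>a j - a i * of_int (c i j)\<rceil>))"
      proof (cases "i \<in> J")
        case False
        with iI have i: "i \<in> I - J" by simp
        with s have "\<forall>l\<in>U i. s l \<noteq> 0" by (auto simp: W_def)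
        with U(3)[OF i] i that(2,3) show ?thesis by blast
      qed (use that in blast)
      then show "\<exists>d Q. polyfn I d Q \<and> ?goal Q"
      proof cases
        case 1
        then have "points J (z(i := n)) = points J z" for z n by (force simp: points_def)
        then have "?goal (\<lambda>_. 0)" by simp
        then show ?thesis using polyfn.const by blast
      next
        case 2
        have "?goal (\<lambda>_. 0)"
        proof (intro ballI allI impI)
          \<comment> \<open>The wall \<open>a i = 0\<close> is never met inside the chamber, so the level \<open>n\<close> that is crossed is nonzero.\<close>
          fix a n assume a: "a \<in> chamber I W s" and n: "a i = real_of_int n"
          define l where "l = (\<lambda>j. if j = i then 1 else 0 :: int)"
          have "l \<in> W" using 2 by (auto simp: W_def l_def)
          have "lin I l a = (\<Sum>j\<in>I. if j = i then a j else 0)"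
            unfolding lin_def l_def by (rule sum.cong) auto
          then have "lin I l a = a i" using iI finite_I by simp
          with a s \<open>l \<in> W\<close> have "a i \<noteq> 0" by (auto simp: chamber_def)
          then have "points J ((\<lambda>j. \<lceil>a j\<rceil>)(i := n + 1)) = points J (\<lambda>j. \<lceil>a j\<rceil>)"
            using points_raise_bound_loop[OF iI 2(2), of "\<lambda>j. \<lceil>a j\<rceil>"] n by simp
          then show "rat_of_nat (card (points J ((\<lambda>j. \<lceil>a j\<rceil>)(i := n + 1)))) -
            of_nat (card (points J (\<lambda>j. \<lceil>a j\<rceil>))) = 0" by simp
        qed
        then show ?thesis using polyfn.const by blast
      next
        case 3
        then obtain d P where P: "polyfn I d P"
          "\<And>a. a \<in> chamber I (U i) s \<Longrightarrow>
              of_nat (card (points (insert i J) (\<lambda>j. \<lceil>a j - a i * of_int (c i j)\<rceil>)))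
             = P (\<lambda>j. of_int \<lceil>a j - a i * of_int (c i j)\<rceil>)" by blast
        define Q where "Q = (\<lambda>x. P (\<lambda>j. x j - x i * of_int (c i j)))"
        have "polyfn I d Q" unfolding Q_def
        proof (rule polyfn_affine_subst[OF P(1)])
          fix j assume "j \<in> I"
          have "polyfn I 1 (\<lambda>x. x j - of_int (c i j) * x i)"
            using polyfn_var[of _ I 0] iI \<open>j \<in> I\<close>
            by (intro polyfn_diff polyfn_cmult) auto
          then show "polyfn I 1 (\<lambda>x. x j - x i * of_int (c i j))" by (simp add: mult.commute)
        qed
        moreover have "?goal Q"
        proof (intro ballI allI impI)
          fix a n assume a: "a \<in> chamber I W s" and n: "a i = real_of_int n"
          have "a \<in> chamber I (U i) s" using a 3(1) by (auto simp: chamber_def W_def)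
          moreover have ceq: "\<lceil>a j - a i * of_int (c i j)\<rceil> = \<lceil>a j\<rceil> - n * c i j" for j
            unfolding n by (metis ceiling_diff_of_int of_int_mult)
          ultimately have "of_nat (card (points (insert i J) (\<lambda>j. \<lceil>a j\<rceil> - n * c i j)))
             = P (\<lambda>j. of_int (\<lceil>a j\<rceil> - n * c i j))"
            using P(2)[of a] by simp
          then show "rat_of_nat (card (points J ((\<lambda>j. \<lceil>a j\<rceil>)(i := n + 1)))) -
            of_nat (card (points J (\<lambda>j. \<lceil>a j\<rceil>))) = Q (\<lambda>j. of_int \<lceil>a j\<rceil>)"
            using card_points_raise_bound[OF 3(1-4), of "\<lambda>j. \<lceil>a j\<rceil>"] n by (simp add: Q_def)
        qed
        ultimately show ?thesis by blast
      qed
    qed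
  qed
qed

end

section \<open>Degree and growth\<close>

lemma polyfn_homogeneous_parts:
  assumes "polyfn I d f"
  shows "\<exists>F. (\<forall>j. polyfn I j (F j)) \<and> (\<forall>j c x. F j (\<lambda>i. c * x i) = c ^ j * F j x) \<and>
    (\<forall>x. f x = (\<Sum>j\<le>d. F j x))"
  using assms
proof (induction rule: polyfn.induct)
  case (const d c)
  show ?case
  proof (intro exI[of _ "\<lambda>j x. if j = 0 then c else 0"] conjI allI)
    show "c = (\<Sum>j\<le>d. if j = 0 then c else 0)" by (simp add: sum.delta)
  qed (auto intro: polyfn.const)
next
  case (var_mult d f i)
  then obtain F where F: "\<And>j. polyfn I j (F j)" "\<And>j c x. F j (\<lambda>i. c * x i) = c ^ j * F j x"
    "\<And>x. f x = (\<Sum>j\<le>d. F j x)" by blast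
  show ?case
  proof (intro exI[of _ "\<lambda>j x. case j of 0 \<Rightarrow> 0 | Suc j' \<Rightarrow> x i * F j' x"] conjI allI)
    show "polyfn I j (\<lambda>x. case j of 0 \<Rightarrow> 0 | Suc j' \<Rightarrow> x i * F j' x)" for j
      using var_mult.hyps(2) F(1) by (cases j) (auto intro: polyfn.intros)
    show "(case j of 0 \<Rightarrow> 0 | Suc j' \<Rightarrow> c * x i * F j' (\<lambda>i. c * x i)) =
       c ^ j * (case j of 0 \<Rightarrow> 0 | Suc j' \<Rightarrow> x i * F j' x)" for j c x
      by (cases j) (simp_all add: F(2))
    show "x i * f x = (\<Sum>j\<le>Suc d. case j of 0 \<Rightarrow> 0 | Suc j' \<Rightarrow> x i * F j' x)" for x
      by (subst sum.atMost_Suc_shift) (simp add: F(3) sum_distrib_left)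
  qed
next
  case (add d f g)
  then obtain F G where F: "\<And>j. polyfn I j (F j)" "\<And>j c x. F j (\<lambda>i. c * x i) = c ^ j * F j x"
    "\<And>x. f x = (\<Sum>j\<le>d. F j x)"
    and G: "\<And>j. polyfn I j (G j)" "\<And>j c x. G j (\<lambda>i. c * x i) = c ^ j * G j x"
    "\<And>x. g x = (\<Sum>j\<le>d. G j x)" by blast
  show ?case
    by (intro exI[of _ "\<lambda>j x. F j x + G j x"] conjI allI)
      (simp_all add: F G polyfn.add sum.distrib distrib_left)
qed

lemma power_quotient_tendsto_0:
  assumes "j < n" shows "(\<lambda>q. real q ^ j / real q ^ n) \<longlonglongrightarrow> 0"
proof -
  have "(\<lambda>q. inverse (real q) ^ (n - j)) \<longlonglongrightarrow> 0 ^ (n - j)"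
    by (intro tendsto_power lim_inverse_n)
  moreover have "\<forall>\<^sub>F q in sequentially. inverse (real q) ^ (n - j) = real q ^ j / real q ^ n"
    using eventually_gt_at_top[of "0::nat"]
    by eventually_elim (use assms in \<open>simp add: power_diff power_inverse field_simps\<close>)
  ultimately show ?thesis
    using assms by (subst (asm) tendsto_cong[of _ "\<lambda>q. real q ^ j / real q ^ n"]) (auto simp: power_0_left)
qed

lemma degree_unique_of_growth:
  fixes c :: "nat \<Rightarrow> rat"
  assumes "c d \<noteq> 0"
    and bounds: "\<And>q::nat. q \<ge> 1 \<Longrightarrow> of_nat q ^ n \<le> (\<Sum>j\<le>d. c j * of_nat q ^ j) \<and>
      (\<Sum>j\<le>d. c j * of_nat q ^ j) \<le> A * of_nat q ^ n"
  shows "d = n"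
proof -
  define g where "g = (\<lambda>q::nat. \<Sum>j\<le>d. real_of_rat (c j) * real q ^ j)"
  have g: "real q ^ n \<le> g q" "g q \<le> real_of_rat A * real q ^ n" if "q \<ge> 1" for q
  proof -
    have "real_of_rat (of_nat q ^ n) \<le> of_rat (\<Sum>j\<le>d. c j * of_nat q ^ j)"
      "real_of_rat (\<Sum>j\<le>d. c j * of_nat q ^ j) \<le> of_rat (A * of_nat q ^ n)"
      using bounds[OF that] by (simp_all only: of_rat_less_eq)
    then show "real q ^ n \<le> g q" "g q \<le> real_of_rat A * real q ^ n"
      by (simp_all add: g_def of_rat_sum of_rat_mult of_rat_power)
  qed
  have gdiv: "g q / real q ^ m = (\<Sum>j\<le>d. real_of_rat (c j) * (real q ^ j / real q ^ m))" for q m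
    by (simp add: g_def sum_divide_distrib)
  have lower: False if "d < n"
  proof -
    have "(\<lambda>q. g q / real q ^ n) \<longlonglongrightarrow> (\<Sum>j\<le>d. real_of_rat (c j) * 0)"
      unfolding gdiv using that
      by (intro tendsto_sum tendsto_mult tendsto_const power_quotient_tendsto_0) auto
    moreover have "\<forall>\<^sub>F q in sequentially. 1 \<le> g q / real q ^ n"
      using eventually_ge_at_top[of "1::nat"]
      by eventually_elim (use g in \<open>simp add: field_simps\<close>)
    ultimately have "1 \<le> (\<Sum>j\<le>d. real_of_rat (c j) * 0)"
      by (intro tendsto_lowerbound[of _ _ sequentially]) auto
    then show False by simp
  qed
  have upper: False if "n < d"
  proof -
    have "(\<lambda>q. g q / real q ^ d) \<longlonglongrightarrow> (\<Sum>j\<le>d. real_of_rat (c j) * (if j = d then 1 else 0))"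
      unfolding gdiv
    proof (intro tendsto_sum tendsto_mult tendsto_const)
      fix j assume "j \<in> {..d}"
      show "(\<lambda>q. real q ^ j / real q ^ d) \<longlonglongrightarrow> (if j = d then 1 else 0)"
      proof (cases "j = d")
        case True
        have "\<forall>\<^sub>F q in sequentially. 1 = real q ^ d / real q ^ d"
          using eventually_gt_at_top[of "0::nat"] by eventually_elim simp
        then show ?thesis using True by (auto intro: tendsto_eventually elim: eventually_mono)
      next
        case False
        with \<open>j \<in> {..d}\<close> show ?thesis using power_quotient_tendsto_0[of j d] by simp
      qed
    qed
    then have lim: "(\<lambda>q. g q / real q ^ d) \<longlonglongrightarrow> real_of_rat (c d)"
      by (simp add: if_distrib sum.delta cong: if_cong)
    have "(\<lambda>q. g q / real q ^ d) \<longlonglongrightarrow> 0"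
    proof (rule tendsto_sandwich)
      show "\<forall>\<^sub>F q in sequentially. 0 \<le> g q / real q ^ d"
        using eventually_ge_at_top[of "1::nat"]
      proof eventually_elim
        case (elim q)
        have "0 \<le> real q ^ n" by simp
        also have "\<dots> \<le> g q" using g elim by blast
        finally show ?case by simp
      qed
      show "\<forall>\<^sub>F q in sequentially. g q / real q ^ d \<le> real_of_rat A * (real q ^ n / real q ^ d)"
        using eventually_ge_at_top[of "1::nat"]
        by eventually_elim (use g in \<open>simp add: divide_right_mono\<close>)
      have "(\<lambda>q. real_of_rat A * (real q ^ n / real q ^ d)) \<longlonglongrightarrow> real_of_rat A * 0"
        using that by (intro tendsto_mult tendsto_const power_quotient_tendsto_0)
      then show "(\<lambda>q. real_of_rat A * (real q ^ n / real q ^ d)) \<longlonglongrightarrow> 0" by simp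
    qed simp
    from LIMSEQ_unique[OF lim this] assms(1) show False by simp
  qed
  from lower upper show ?thesis by force
qed

text \<open>
  Along the ray through a point where the leading form does not vanish, the function is a univariate
  polynomial of degree exactly \<open>d\<close>, and its growth tells the degree.
\<close>

lemma minimal_degree_eq_growth:
  assumes "finite I" "finite W" "\<And>l. l \<in> W \<Longrightarrow> s l \<noteq> 0" "chamber I W s \<noteq> {}"
    and f: "polyfn I d f" and minimal: "\<And>d'. polyfn I d' f \<Longrightarrow> d \<le> d'"
    and growth: "\<And>k :: 'i \<Rightarrow> int. (\<lambda>i. of_int (k i)) \<in> chamber I W s \<Longrightarrow>
      \<exists>T A. \<forall>q\<ge>1. of_nat q ^ n \<le> f (\<lambda>i. of_nat (q * T) * of_int (k i)) \<and>
        f (\<lambda>i. of_nat (q * T) * of_int (k i)) \<le> A * of_nat q ^ n \<and> T \<ge> 1"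
  shows "d = n"
proof -
  obtain a where a: "a \<in> chamber I W s" using assms(4) by auto
  obtain F where F: "\<And>j. polyfn I j (F j)" "\<And>j c x. F j (\<lambda>i. c * x i) = c ^ j * F j x"
    "\<And>x. f x = (\<Sum>j\<le>d. F j x)" using polyfn_homogeneous_parts[OF f] by blast
  obtain z0 :: "'i \<Rightarrow> int" where z0: "\<And>z. (\<And>i. i \<in> I \<Longrightarrow> z0 i \<le> z i \<and> z i \<le> z0 i + int d) \<Longrightarrow>
      (\<lambda>i. of_int (z i)) \<in> chamber I W s"
    using chamber_contains_box[OF assms(2,1,3) a, of d] by metis
  \<comment> \<open>The leading form cannot vanish at every integer point of the chamber: it would vanish identically, so that \<open>d\<close> would not be minimal or, for \<open>d = 0\<close>, the function would be 0.\<close>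
  have "\<exists>k. (\<lambda>i. of_int (k i)) \<in> chamber I W s \<and> F d (\<lambda>i. of_int (k i)) \<noteq> 0"
  proof (rule ccontr)
    assume contr: "\<not> ?thesis"
    have Fd: "F d x = 0" for x
    proof (rule polyfn_eq_0_if_grid[OF F(1) assms(1), where T = "\<lambda>i. of_int ` {z0 i..z0 i + int d}"])
      fix i assume "i \<in> I"
      show "finite (rat_of_int ` {z0 i..z0 i + int d}) \<and> d < card (rat_of_int ` {z0 i..z0 i + int d})"
        by (subst card_image) (auto simp: inj_on_def)
    next
      fix x assume "\<And>i. i \<in> I \<Longrightarrow> x i \<in> rat_of_int ` {z0 i..z0 i + int d}"
      then have "\<forall>i\<in>I. \<exists>z. x i = of_int z \<and> z0 i \<le> z \<and> z \<le> z0 i + int d" by force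
      then obtain z where z: "\<And>i. i \<in> I \<Longrightarrow> x i = of_int (z i) \<and> z0 i \<le> z i \<and> z i \<le> z0 i + int d"
        by metis
      have "F d x = F d (\<lambda>i. of_int (z i))" by (rule polyfn_cong_vars[OF F(1)]) (use z in auto)
      also have "\<dots> = 0" using contr z0[of z] z by blast
      finally show "F d x = 0" .
    qed
    show False
    proof (cases d)
      case 0
      obtain k :: "'i \<Rightarrow> int" where k: "(\<lambda>i. of_int (k i)) \<in> chamber I W s" using z0[of z0] by auto
      obtain T A where "of_nat 1 ^ n \<le> f (\<lambda>i. of_nat (1 * T) * of_int (k i))"
        using growth[OF k] by blast
      moreover have "f x = 0" for x using F(3)[of x] Fd 0 by simp
      ultimately show False by simp
    next
      case (Suc d')
      have "f = (\<lambda>x. \<Sum>j\<le>d'. F j x)" using F(3) Fd Suc by (simp add: fun_eq_iff)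
      moreover have "polyfn I d' (\<lambda>x. \<Sum>j\<le>d'. F j x)"
        by (intro polyfn_sum) (auto intro: polyfn_mono[OF F(1)])
      ultimately show False using minimal[of d'] Suc by simp
    qed
  qed
  then obtain k where k: "(\<lambda>i. of_int (k i)) \<in> chamber I W s" "F d (\<lambda>i. of_int (k i)) \<noteq> 0" by blast
  obtain T A where TA: "\<And>q. q \<ge> 1 \<Longrightarrow> of_nat q ^ n \<le> f (\<lambda>i. of_nat (q * T) * of_int (k i)) \<and>
        f (\<lambda>i. of_nat (q * T) * of_int (k i)) \<le> A * of_nat q ^ n \<and> T \<ge> 1"
    using growth[OF k(1)] by blast
  have eq: "f (\<lambda>i. of_nat (q * T) * of_int (k i)) =
      (\<Sum>j\<le>d. (of_nat T ^ j * F j (\<lambda>i. of_int (k i))) * of_nat q ^ j)" for q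
    unfolding F(3) F(2) by (simp add: power_mult_distrib mult_ac)
  show ?thesis
  proof (rule degree_unique_of_growth[where c = "\<lambda>j. of_nat T ^ j * F j (\<lambda>i. of_int (k i))" and A = A])
    show "of_nat T ^ d * F d (\<lambda>i. of_int (k i)) \<noteq> 0" using k(2) TA[of 1] by simp
  qed (use TA eq in auto)
qed

section \<open>Formal polynomials\<close>

definition monom_eval :: "('e \<Rightarrow>\<^sub>0 nat) \<Rightarrow> ('e \<Rightarrow> rat) \<Rightarrow> rat" where
  "monom_eval m x = (\<Prod>e\<in>Poly_Mapping.keys m. x e ^ Poly_Mapping.lookup m e)"

lemma monom_eval_superset:
  assumes "finite A" "Poly_Mapping.keys m \<subseteq> A"
  shows "monom_eval m x = (\<Prod>e\<in>A. x e ^ Poly_Mapping.lookup m e)"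
  unfolding monom_eval_def
  by (rule prod.mono_neutral_left) (use assms in \<open>auto simp: in_keys_iff\<close>)

lemma monomial_degree_superset:
  assumes "finite A" "Poly_Mapping.keys m \<subseteq> A"
  shows "monomial_degree m = (\<Sum>e\<in>A. Poly_Mapping.lookup m e)"
  unfolding monomial_degree_def
  by (rule sum.mono_neutral_left) (use assms in \<open>auto simp: in_keys_iff\<close>)

lemma monom_eval_add: "monom_eval (m + m') x = monom_eval m x * monom_eval m' x"
proof -
  let ?A = "Poly_Mapping.keys m \<union> Poly_Mapping.keys m'"
  have "finite ?A" by simp
  moreover have "Poly_Mapping.keys (m + m') \<subseteq> ?A" by (rule Poly_Mapping.keys_add)
  ultimately show ?thesis
    by (simp add: monom_eval_superset[of ?A] lookup_add power_add prod.distrib)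
qed

lemma monomial_degree_add: "monomial_degree (m + m') = monomial_degree m + monomial_degree m'"
proof -
  let ?A = "Poly_Mapping.keys m \<union> Poly_Mapping.keys m'"
  have "finite ?A" by simp
  moreover have "Poly_Mapping.keys (m + m') \<subseteq> ?A" by (rule Poly_Mapping.keys_add)
  ultimately show ?thesis
    by (simp add: monomial_degree_superset[of ?A] lookup_add sum.distrib)
qed

lemma eval_mpoly_superset:
  assumes "finite A" "Poly_Mapping.keys p \<subseteq> A"
  shows "eval_mpoly p x = (\<Sum>m\<in>A. Poly_Mapping.lookup p m * monom_eval m x)"
  unfolding eval_mpoly_def monom_eval_def
  by (rule sum.mono_neutral_left) (use assms in \<open>auto simp: in_keys_iff\<close>)

lemma eval_mpoly_add: "eval_mpoly (p + q) x = eval_mpoly p x + eval_mpoly q x"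
proof -
  let ?A = "Poly_Mapping.keys p \<union> Poly_Mapping.keys q"
  have "finite ?A" by simp
  moreover have "Poly_Mapping.keys (p + q) \<subseteq> ?A" by (rule Poly_Mapping.keys_add)
  ultimately show ?thesis
    by (simp add: eval_mpoly_superset[of ?A] lookup_add distrib_right sum.distrib)
qed

text \<open>
  Only an upper bound for the total degree: a formal polynomial of this kind exists if and only if the function
  is in the class \<open>polyfn E d\<close>.
\<close>

definition mpoly_represents :: "'e set \<Rightarrow> nat \<Rightarrow> 'e rat_mpoly \<Rightarrow> (('e \<Rightarrow> rat) \<Rightarrow> rat) \<Rightarrow> bool" where
  "mpoly_represents E d p f \<longleftrightarrow> p \<in> polys_over E \<and>
     (\<forall>m\<in>Poly_Mapping.keys p. monomial_degree m \<le> d) \<and> (\<forall>x. eval_mpoly p x = f x)"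

lemma mpoly_represents_add:
  assumes "mpoly_represents E d p f" "mpoly_represents E d q g"
  shows "mpoly_represents E d (p + q) (\<lambda>x. f x + g x)"
  using assms Poly_Mapping.keys_add[of p q]
  by (auto simp: mpoly_represents_def polys_over_def eval_mpoly_add)

lemma mpoly_represents_single:
  assumes "Poly_Mapping.keys m \<subseteq> E" "monomial_degree m \<le> d"
  shows "mpoly_represents E d (Poly_Mapping.single m c) (\<lambda>x. c * monom_eval m x)"
proof -
  have "eval_mpoly (Poly_Mapping.single m c) x = c * monom_eval m x" for x
    by (subst eval_mpoly_superset[of "{m}"]) auto
  then show ?thesis using assms by (auto simp: mpoly_represents_def polys_over_def)
qed

lemma mpoly_represents_sum:
  assumes "finite A" "\<And>a. a \<in> A \<Longrightarrow> \<exists>p. mpoly_represents E d p (f a)"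
  shows "\<exists>p. mpoly_represents E d p (\<lambda>x. \<Sum>a\<in>A. f a x)"
  using assms
proof (induction A rule: finite_induct)
  case empty
  have "mpoly_represents E d 0 (\<lambda>x. 0)"
    by (auto simp: mpoly_represents_def polys_over_def eval_mpoly_def)
  then show ?case by auto
next
  case (insert a A)
  then show ?case using mpoly_represents_add by (fastforce simp: insert.hyps)
qed

lemma polyfn_imp_mpoly:
  "polyfn E d f \<Longrightarrow> \<exists>p. mpoly_represents E d p f"
proof (induction rule: polyfn.induct)
  case (const d c)
  have "mpoly_represents E d (Poly_Mapping.single 0 c) (\<lambda>x. c * monom_eval 0 x)"
    by (rule mpoly_represents_single) (auto simp: monomial_degree_def)
  then show ?case by (auto simp: monom_eval_def)
next
  case (var_mult d f e)
  then obtain p where p: "mpoly_represents E d p f" by blast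
  let ?e = "Poly_Mapping.single e (1::nat)"
  have "\<exists>q. mpoly_represents E (Suc d) q (\<lambda>x. \<Sum>m\<in>Poly_Mapping.keys p. Poly_Mapping.lookup p m * monom_eval (m + ?e) x)"
  proof (rule mpoly_represents_sum)
    fix m assume m: "m \<in> Poly_Mapping.keys p"
    have "Poly_Mapping.keys (m + ?e) \<subseteq> E"
      using Poly_Mapping.keys_add[of m ?e] m p var_mult.hyps(2)
      by (auto simp: mpoly_represents_def polys_over_def)
    moreover have "monomial_degree (m + ?e) \<le> Suc d"
      using m p unfolding monomial_degree_add by (auto simp: mpoly_represents_def monomial_degree_def)
    ultimately show "\<exists>q. mpoly_represents E (Suc d) q (\<lambda>x. Poly_Mapping.lookup p m * monom_eval (m + ?e) x)"
      using mpoly_represents_single by blast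
  qed simp
  moreover have "(\<lambda>x. \<Sum>m\<in>Poly_Mapping.keys p. Poly_Mapping.lookup p m * monom_eval (m + ?e) x) = (\<lambda>x. x e * f x)"
  proof
    fix x
    have "f x = eval_mpoly p x" using p by (simp add: mpoly_represents_def)
    moreover have "monom_eval ?e x = x e" by (simp add: monom_eval_def)
    ultimately show "(\<Sum>m\<in>Poly_Mapping.keys p. Poly_Mapping.lookup p m * monom_eval (m + ?e) x) = x e * f x"
      by (simp add: monom_eval_add eval_mpoly_def monom_eval_def[symmetric] sum_distrib_left mult_ac)
  qed
  ultimately show ?case by simp
next
  case (add d f g)
  then show ?case using mpoly_represents_add by blast
qed

lemma mpoly_imp_polyfn:
  assumes "mpoly_represents E d p f"
  shows "polyfn E d f"
proof -
  have pow: "polyfn E n (\<lambda>x. x e ^ n)" if "e \<in> E" for e n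
    using that by (induction n) (auto intro: polyfn.intros)
  have prod: "polyfn E (\<Sum>e\<in>A. g e) (\<lambda>x. \<Prod>e\<in>A. x e ^ g e)" if "finite A" "A \<subseteq> E" for A and g :: "_ \<Rightarrow> nat"
    using that by (induction A rule: finite_induct) (auto intro: polyfn.const polyfn_mult pow)
  have "f = (\<lambda>x. \<Sum>m\<in>Poly_Mapping.keys p. Poly_Mapping.lookup p m * monom_eval m x)"
    using assms by (auto simp: mpoly_represents_def eval_mpoly_def monom_eval_def)
  moreover have "polyfn E d (\<lambda>x. \<Sum>m\<in>Poly_Mapping.keys p. Poly_Mapping.lookup p m * monom_eval m x)"
  proof (intro polyfn_sum polyfn_cmult)
    fix m assume m: "m \<in> Poly_Mapping.keys p"
    then have "Poly_Mapping.keys m \<subseteq> E" "monomial_degree m \<le> d"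
      using assms by (auto simp: mpoly_represents_def polys_over_def)
    then show "polyfn E d (monom_eval m)"
      using polyfn_mono[OF prod[of "Poly_Mapping.keys m" "Poly_Mapping.lookup m"]]
      unfolding monom_eval_def monomial_degree_def by auto
  qed
  ultimately show ?thesis by simp
qed

text \<open>
  The degree of the polynomial cannot drop below \<open>d\<close>, because any representation gives back a
  bound on the degree of the function.
\<close>

lemma mpoly_of_minimal_degree:
  assumes "polyfn E d f" and minimal: "\<And>d'. polyfn E d' f \<Longrightarrow> d \<le> d'" and "f x \<noteq> 0"
  shows "\<exists>p\<in>polys_over E. has_total_degree p d \<and> (\<forall>x. eval_mpoly p x = f x)"
proof -
  obtain p where p: "mpoly_represents E d p f" using polyfn_imp_mpoly[OF assms(1)] by blast
  have "p \<noteq> 0" using p assms(3) by (auto simp: mpoly_represents_def eval_mpoly_def)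
  define d' where "d' = Max (monomial_degree ` Poly_Mapping.keys p)"
  have ne: "monomial_degree ` Poly_Mapping.keys p \<noteq> {}" using \<open>p \<noteq> 0\<close> by simp
  have "d' \<le> d" unfolding d'_def using ne p by (auto simp: mpoly_represents_def)
  have "mpoly_represents E d' p f" using p by (auto simp: mpoly_represents_def d'_def)
  then have "d \<le> d'" using minimal mpoly_imp_polyfn by blast
  with \<open>d' \<le> d\<close> have "d' = d" by simp
  then have "has_total_degree p d" using \<open>p \<noteq> 0\<close> by (simp add: has_total_degree_def d'_def)
  then show ?thesis using p by (auto simp: mpoly_represents_def)
qed

section \<open>Flows, circuits and components\<close>

text \<open>
  A finite multigraph together with an orientation. Flows extend by 0 outside the edge set, so that the flows
  supported on a smaller edge set form a subset and not a different type of objects.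
\<close>

locale oriented_multigraph =
  fixes V :: "'v set" and E :: "'e set" and ends :: "'e \<Rightarrow> 'v set" and h t :: "'e \<Rightarrow> 'v"
  assumes finite_V: "finite V" and finite_E: "finite E"
    and ends: "e \<in> E \<Longrightarrow> ends e = {h e, t e}"
    and h_in_V: "e \<in> E \<Longrightarrow> h e \<in> V" and t_in_V: "e \<in> E \<Longrightarrow> t e \<in> V"
begin

definition excess :: "('e \<Rightarrow> int) \<Rightarrow> 'v \<Rightarrow> int" where
  "excess x v = (\<Sum>e\<in>E. x e * (of_bool (h e = v) - of_bool (t e = v)))"

definition flows :: "'e set \<Rightarrow> ('e \<Rightarrow> int) set" where
  "flows S = {x. (\<forall>e. e \<notin> S \<longrightarrow> x e = 0) \<and> (\<forall>v. excess x v = 0)}"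

lemma excess_add: "excess (\<lambda>e. x e + y e) v = excess x v + excess y v"
  by (simp add: excess_def sum.distrib distrib_right)

lemma excess_diff: "excess (\<lambda>e. x e - y e) v = excess x v - excess y v"
  by (simp add: excess_def sum_subtractf left_diff_distrib)

lemma excess_cmult: "excess (\<lambda>e. c * x e) v = c * excess x v"
  by (simp add: excess_def sum_distrib_left mult.assoc)

lemma excess_sum: "excess (\<lambda>e. \<Sum>b\<in>B. f b e) v = (\<Sum>b\<in>B. excess (f b) v)"
  unfolding excess_def sum_distrib_right by (rule sum.swap)

lemma excess_upd:
  assumes "e \<in> E"
  shows "excess (x(e := x e + c)) v = excess x v + c * (of_bool (h e = v) - of_bool (t e = v))"
proof -
  have "excess (x(e := x e + c)) v = (\<Sum>e'\<in>E. x e' * (of_bool (h e' = v) - of_bool (t e' = v)) +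
      (if e' = e then c * (of_bool (h e = v) - of_bool (t e = v)) else 0))"
    unfolding excess_def by (rule sum.cong) (auto simp: algebra_simps)
  then show ?thesis using assms finite_E by (simp add: sum.distrib excess_def)
qed

lemma flows_mono: "S \<subseteq> S' \<Longrightarrow> flows S \<subseteq> flows S'"
  by (auto simp: flows_def)

lemma flows_add: "x \<in> flows S \<Longrightarrow> y \<in> flows S \<Longrightarrow> (\<lambda>e. x e + y e) \<in> flows S"
  by (simp add: flows_def excess_add)

lemma flows_diff: "x \<in> flows S \<Longrightarrow> y \<in> flows S \<Longrightarrow> (\<lambda>e. x e - y e) \<in> flows S"
  by (simp add: flows_def excess_diff)

lemma flows_cmult: "x \<in> flows S \<Longrightarrow> (\<lambda>e. c * x e) \<in> flows S"
  by (simp add: flows_def excess_cmult)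

lemma flows_sum: "(\<And>b. b \<in> B \<Longrightarrow> f b \<in> flows S) \<Longrightarrow> (\<lambda>e. \<Sum>b\<in>B. f b e) \<in> flows S"
  by (simp add: flows_def excess_sum)

text \<open>
  Walking along a path, each edge contributes 1 or -1 according to its orientation.
\<close>

lemma unit_path:
  assumes "(u, w) \<in> (adjacent S ends)\<^sup>*" "S \<subseteq> E"
  shows "\<exists>x. (\<forall>e. e \<notin> S \<longrightarrow> x e = 0) \<and> (\<forall>v. excess x v = of_bool (w = v) - of_bool (u = v))"
  using assms(1)
proof (induction rule: rtrancl_induct)
  case base
  show ?case by (rule exI[of _ "\<lambda>_. 0"]) (simp add: excess_def)
next
  case (step w w')
  then obtain x where x: "\<And>e. e \<notin> S \<Longrightarrow> x e = 0"
    "\<And>v. excess x v = of_bool (w = v) - of_bool (u = v)" by auto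
  obtain e where e: "e \<in> S" "ends e = {w, w'}" using step.hyps(2) by (auto simp: adjacent_def)
  then have "e \<in> E" using assms(2) by auto
  then have "h e = w' \<and> t e = w \<or> h e = w \<and> t e = w'"
    using e(2) ends[OF \<open>e \<in> E\<close>] by (auto simp: doubleton_eq_iff)
  then show ?case
  proof
    assume "h e = w' \<and> t e = w"
    then show ?thesis using x e
      by (intro exI[of _ "x(e := x e + 1)"]) (auto simp: fun_upd_def excess_upd[OF \<open>e \<in> E\<close>, unfolded fun_upd_def])
  next
    assume "h e = w \<and> t e = w'"
    then show ?thesis using x e
      by (intro exI[of _ "x(e := x e + (-1))"]) (auto simp: fun_upd_def excess_upd[OF \<open>e \<in> E\<close>, of x "-1", unfolded fun_upd_def] simp del: add_uminus_conv_diff)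
  qed
qed

lemma flow_through_edge:
  assumes "(h e, t e) \<in> (adjacent S ends)\<^sup>*" "S \<subseteq> E" "e \<in> E" "e \<notin> S"
  shows "\<exists>c\<in>flows (insert e S). c e = 1"
proof -
  obtain x where x: "\<And>e. e \<notin> S \<Longrightarrow> x e = 0"
    "\<And>v. excess x v = of_bool (t e = v) - of_bool (h e = v)"
    using unit_path[OF assms(1,2)] by auto
  then have "x(e := x e + 1) \<in> flows (insert e S)"
    by (auto simp: flows_def excess_upd[OF assms(3)])
  moreover have "(x(e := x e + 1)) e = 1" using x assms(4) by simp
  ultimately show ?thesis by blast
qed

lemma sym_reachable: "sym ((adjacent S ends)\<^sup>*)"
  by (rule sym_rtrancl) (auto simp: adjacent_def sym_def insert_commute)

lemma flow_on_separating_edge: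
  assumes "(h e, t e) \<notin> (adjacent S ends)\<^sup>*" "S \<subseteq> E" "e \<in> E" "x \<in> flows (insert e S)"
  shows "x e = 0"
proof -
  \<comment> \<open>Summing the conservation law over the component of \<open>h e\<close> leaves only the edge that crosses its boundary.\<close>
  define K where "K = {v \<in> V. (h e, v) \<in> (adjacent S ends)\<^sup>*}"
  have "finite K" using finite_V by (simp add: K_def)
  have "0 = (\<Sum>v\<in>K. excess x v)" using assms(4) by (simp add: flows_def)
  also have "\<dots> = (\<Sum>e'\<in>E. \<Sum>v\<in>K. x e' * (of_bool (h e' = v) - of_bool (t e' = v)))"
    unfolding excess_def by (rule sum.swap)
  also have "\<dots> = (\<Sum>e'\<in>E. x e' * (of_bool (h e' \<in> K) - of_bool (t e' \<in> K)))"
    using \<open>finite K\<close> by (intro sum.cong) (auto simp: sum_distrib_left[symmetric] sum_subtractf of_bool_def)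
  also have "\<dots> = (\<Sum>e'\<in>E. if e' = e then x e else 0)"
  proof (rule sum.cong)
    fix e' assume "e' \<in> E"
    consider "e' = e" | "e' \<noteq> e" "e' \<in> S" | "e' \<noteq> e" "e' \<notin> S" by blast
    then show "x e' * (of_bool (h e' \<in> K) - of_bool (t e' \<in> K)) = (if e' = e then x e else 0)"
    proof cases
      case 1
      then have "h e' \<in> K" "t e' \<notin> K" using assms(1) h_in_V[OF assms(3)] by (auto simp: K_def)
      with 1 show ?thesis by simp
    next
      case 2
      then have "(h e', t e') \<in> adjacent S ends" "(t e', h e') \<in> adjacent S ends"
        using ends[OF \<open>e' \<in> E\<close>] by (auto simp: adjacent_def insert_commute)
      then have "h e' \<in> K \<longleftrightarrow> t e' \<in> K"
        using h_in_V[OF \<open>e' \<in> E\<close>] t_in_V[OF \<open>e' \<in> E\<close>]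
        unfolding K_def by (auto intro: rtrancl_into_rtrancl)
      with 2 show ?thesis by simp
    next
      case 3
      with assms(4) show ?thesis by (simp add: flows_def)
    qed
  qed simp
  also have "\<dots> = x e" using assms(3) finite_E by simp
  finally show ?thesis by simp
qed

text \<open>
  Either the ends of \<open>e\<close> are joined by a path that avoids \<open>e\<close>, which closes up to a circuit
  carrying a unit flow, or \<open>e\<close> separates its ends and conservation forces the value 0.
\<close>

lemma unimodular_flows:
  assumes "S \<subseteq> E" "e \<in> E"
  shows "(\<forall>x\<in>flows S. x e = 0) \<or> (\<exists>c\<in>flows S. c e = 1)"
proof (cases "e \<in> S \<and> (h e, t e) \<in> (adjacent (S - {e}) ends)\<^sup>*")
  case True
  then show ?thesis using flow_through_edge[of e "S - {e}"] assms by (auto simp: insert_absorb)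
next
  case False
  have "x e = 0" if "x \<in> flows S" for x
  proof (cases "e \<in> S")
    case True
    with False show ?thesis using flow_on_separating_edge[of e "S - {e}" x] assms that
      by (auto simp: insert_absorb)
  qed (use that in \<open>auto simp: flows_def\<close>)
  then show ?thesis by blast
qed

definition linked :: "'e set \<Rightarrow> ('v \<times> 'v) set" where
  "linked S = {(u, v). u \<in> V \<and> v \<in> V \<and> (u, v) \<in> (adjacent S ends)\<^sup>*}"

lemma equiv_linked: "equiv V (linked S)"
proof (rule equivI)
  show "refl_on V (linked S)" by (auto simp: linked_def refl_on_def)
  show "sym (linked S)" using sym_reachable[of S] by (auto simp: linked_def sym_def)
  show "trans (linked S)" by (auto simp: linked_def trans_def intro: rtrancl_trans)
  show "linked S \<subseteq> V \<times> V" by (auto simp: linked_def)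
qed

lemma components_linked: "components V S ends = V // linked S"
  by (simp add: components_def linked_def)

lemma linked_insert:
  assumes "e \<in> E" "S \<subseteq> E"
  shows "linked (insert e S) = linked S \<union>
    {(u, v). (u, h e) \<in> linked S \<and> (t e, v) \<in> linked S} \<union>
    {(u, v). (u, t e) \<in> linked S \<and> (h e, v) \<in> linked S}" (is "_ = ?R")
proof
  have hv: "h e \<in> V" "t e \<in> V" using h_in_V t_in_V assms(1) by auto
  have refl: "(v, v) \<in> linked S" if "v \<in> V" for v using that by (simp add: linked_def)
  have tr: "(u, v) \<in> linked S \<Longrightarrow> (v, w) \<in> linked S \<Longrightarrow> (u, w) \<in> linked S" for u v w
    using equiv_linked[of S] by (meson equivE transE)
  have sy: "(u, v) \<in> linked S \<Longrightarrow> (v, u) \<in> linked S" for u v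
    using equiv_linked[of S] by (meson equivE symE)
  show "linked (insert e S) \<subseteq> ?R"
  proof
    fix p assume p: "p \<in> linked (insert e S)"
    obtain u v where [simp]: "p = (u, v)" by force
    have "u \<in> V" and uv: "(u, v) \<in> (adjacent (insert e S) ends)\<^sup>*" and "v \<in> V"
      using p by (auto simp: linked_def)
    have "v \<in> V \<longrightarrow> (u, v) \<in> ?R" using uv
    proof (induction rule: rtrancl_induct)
      case base
      show ?case using \<open>u \<in> V\<close> refl by simp
    next
      case (step v w)
      obtain e' where e': "e' \<in> insert e S" "ends e' = {v, w}"
        using step.hyps(2) by (auto simp: adjacent_def)
      show ?case
      proof
        assume "w \<in> V"
        show "(u, w) \<in> ?R"
        proof (cases "e' \<in> S")
          case True
          then have vw: "(v, w) \<in> adjacent S ends" using e' by (auto simp: adjacent_def)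
          have "e' \<in> E" using True assms(2) by auto
          then have "{v, w} \<subseteq> V" using ends[of e'] h_in_V[of e'] t_in_V[of e'] unfolding e'(2) by auto
          then have "v \<in> V" "(v, w) \<in> linked S" using vw by (auto simp: linked_def)
          with step.IH tr show ?thesis by blast
        next
          case False
          then have "{v, w} = {h e, t e}" using e' ends[OF assms(1)] by auto
          then have "v = h e \<and> w = t e \<or> v = t e \<and> w = h e" by (auto simp: doubleton_eq_iff)
          with step.IH hv refl tr sy show ?thesis by blast
        qed
      qed
    qed
    with \<open>v \<in> V\<close> show "p \<in> ?R" by simp
  qed
  have mono: "linked S \<subseteq> linked (insert e S)"
    unfolding linked_def adjacent_def by (auto elim!: rtrancl_mono[THEN subsetD, rotated])
  have e: "(h e, t e) \<in> linked (insert e S)" "(t e, h e) \<in> linked (insert e S)"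
    using hv ends[OF assms(1)] by (auto simp: linked_def adjacent_def insert_commute)
  have tr': "(u, v) \<in> linked (insert e S) \<Longrightarrow> (v, w) \<in> linked (insert e S) \<Longrightarrow> (u, w) \<in> linked (insert e S)" for u v w
    using equiv_linked[of "insert e S"] by (meson equivE transE)
  show "?R \<subseteq> linked (insert e S)" using mono e tr' by blast
qed

lemma components_insert_linked:
  assumes "e \<in> E" "S \<subseteq> E" "(h e, t e) \<in> linked S"
  shows "components V (insert e S) ends = components V S ends"
proof -
  have "linked (insert e S) = linked S"
    using equiv_linked[of S] assms(3) unfolding linked_insert[OF assms(1,2)]
    by (auto elim!: equivE dest: symE transE)
  then show ?thesis by (simp add: components_linked)
qed

text \<open>
  The classes of the two ends merge into one class and all other classes stay.
\<close>

lemma card_components_insert_unlinked: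
  assumes "e \<in> E" "S \<subseteq> E" "(h e, t e) \<notin> linked S"
  shows "card (components V S ends) = Suc (card (components V (insert e S) ends))"
proof -
  define A where "A = linked S `` {h e}"
  define B where "B = linked S `` {t e}"
  have hv: "h e \<in> V" "t e \<in> V" using h_in_V t_in_V assms(1) by auto
  have refl: "(v, v) \<in> linked S" if "v \<in> V" for v using that by (simp add: linked_def)
  have tr: "(u, v) \<in> linked S \<Longrightarrow> (v, w) \<in> linked S \<Longrightarrow> (u, w) \<in> linked S" for u v w
    using equiv_linked[of S] by (meson equivE transE)
  have sy: "(u, v) \<in> linked S \<Longrightarrow> (v, u) \<in> linked S" for u v
    using equiv_linked[of S] by (meson equivE symE)
  have AB: "A \<in> V // linked S" "B \<in> V // linked S" "A \<noteq> B" "A \<noteq> {}" "B \<noteq> {}"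
    using hv assms(3) refl by (auto simp: A_def B_def quotient_def)
  have cls: "linked (insert e S) `` {v} = (if v \<in> A \<union> B then A \<union> B else linked S `` {v})" for v
  proof (rule set_eqI)
    fix w
    have "w \<in> linked (insert e S) `` {v} \<longleftrightarrow>
        (v, w) \<in> linked S \<or> (v, h e) \<in> linked S \<and> (t e, w) \<in> linked S \<or>
        (v, t e) \<in> linked S \<and> (h e, w) \<in> linked S"
      unfolding linked_insert[OF assms(1,2)] by simp
    moreover have "v \<in> A \<union> B \<longleftrightarrow> (v, h e) \<in> linked S \<or> (v, t e) \<in> linked S"
      unfolding A_def B_def using sy by blast
    moreover have "w \<in> A \<union> B \<longleftrightarrow> (h e, w) \<in> linked S \<or> (t e, w) \<in> linked S"
      unfolding A_def B_def by blast
    moreover have "(h e, w) \<in> linked S \<longleftrightarrow> (v, w) \<in> linked S" if "(v, h e) \<in> linked S"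
      using tr[OF that] tr[OF sy[OF that]] by blast
    moreover have "(t e, w) \<in> linked S \<longleftrightarrow> (v, w) \<in> linked S" if "(v, t e) \<in> linked S"
      using tr[OF that] tr[OF sy[OF that]] by blast
    ultimately show "w \<in> linked (insert e S) `` {v} \<longleftrightarrow>
        w \<in> (if v \<in> A \<union> B then A \<union> B else linked S `` {v})"
      by (cases "(v, h e) \<in> linked S"; cases "(v, t e) \<in> linked S") (simp_all add: disj_commute)
  qed
  have eq: "V // linked (insert e S) = insert (A \<union> B) (V // linked S - {A, B})"
  proof
    show "V // linked (insert e S) \<subseteq> insert (A \<union> B) (V // linked S - {A, B})"
    proof
      fix X assume "X \<in> V // linked (insert e S)"
      then obtain v where v: "v \<in> V" "X = linked (insert e S) `` {v}" by (auto simp: quotient_def)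
      show "X \<in> insert (A \<union> B) (V // linked S - {A, B})"
      proof (cases "v \<in> A \<union> B")
        case False
        then have "X = linked S `` {v}" using v cls by simp
        moreover have "v \<in> linked S `` {v}" using v refl by simp
        ultimately show ?thesis using v False by (auto simp: quotient_def)
      qed (use v cls in simp)
    qed
    show "insert (A \<union> B) (V // linked S - {A, B}) \<subseteq> V // linked (insert e S)"
    proof
      fix X assume "X \<in> insert (A \<union> B) (V // linked S - {A, B})"
      then consider "X = A \<union> B" | v where "v \<in> V" "X = linked S `` {v}" "X \<noteq> A" "X \<noteq> B"
        by (auto simp: quotient_def)
      then show "X \<in> V // linked (insert e S)"
      proof cases
        case 1
        have "h e \<in> A" using hv refl by (simp add: A_def)
        with 1 cls[of "h e"] hv show ?thesis by (auto simp: quotient_def)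
      next
        case 2
        have "v \<notin> A \<union> B"
        proof
          assume "v \<in> A \<union> B"
          then have "X = A \<or> X = B"
            using equiv_class_eq[OF equiv_linked, of "h e" v S] equiv_class_eq[OF equiv_linked, of "t e" v S]
            unfolding 2(2) A_def B_def by auto
          with 2 show False by simp
        qed
        with 2 cls[of v] show ?thesis by (auto simp: quotient_def)
      qed
    qed
  qed
  have fin: "finite (V // linked S)" using finite_V equiv_linked[of S] by (intro finite_quotient) (auto simp: linked_def)
  have "A \<union> B \<notin> V // linked S"
  proof
    assume "A \<union> B \<in> V // linked S"
    then obtain v where "A \<union> B = linked S `` {v}" by (auto simp: quotient_def)
    moreover have "h e \<in> A" "t e \<in> B" using hv refl by (auto simp: A_def B_def)
    ultimately have "(v, h e) \<in> linked S" "(v, t e) \<in> linked S" by auto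
    with assms(3) tr[OF sy[of v "h e"], of "t e"] show False by simp
  qed
  then have "card (V // linked (insert e S)) = Suc (card (V // linked S - {A, B}))"
    unfolding eq using fin by simp
  also have "card (V // linked S - {A, B}) = card (V // linked S) - 2"
    using AB fin by (subst card_Diff_subset) auto
  finally have "card (V // linked (insert e S)) = Suc (card (V // linked S) - 2)" .
  moreover have "card {A, B} \<le> card (V // linked S)" using AB fin by (intro card_mono) auto
  ultimately show ?thesis using AB(3) by (simp add: components_linked)
qed

text \<open>
  A basis of the flow lattice in the style of fundamental circuits: the coordinates in \<open>B\<close> determine
  a flow, and the flows \<open>c b\<close> are dual to these coordinates. Adding the edges one by one, \<open>B\<close>
  consists of the edges that close a circuit, and every other edge reduces the number of components by one;
  hence \<open>card B\<close> is the cyclomatic number.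
\<close>

lemma fundamental_flows:
  assumes "S \<subseteq> E"
  shows "\<exists>B\<subseteq>S. card B + card V = card S + card (components V S ends) \<and>
    (\<forall>x\<in>flows S. (\<forall>b\<in>B. x b = 0) \<longrightarrow> (\<forall>e. x e = 0)) \<and>
    (\<exists>c. \<forall>b\<in>B. c b \<in> flows S \<and> (\<forall>b'\<in>B. c b b' = of_bool (b = b')))"
  using finite_subset[OF assms finite_E] assms
proof (induction S rule: finite_induct)
  case empty
  have "linked {} = Id_on V" by (auto simp: linked_def adjacent_def)
  then have "components V {} ends = (\<lambda>v. {v}) ` V" by (auto simp: components_linked quotient_def)
  then have "card (components V {} ends) = card V" by (simp add: card_image)
  then show ?case by (auto simp: flows_def)
next
  case (insert e S)
  then have e: "e \<in> E" "S \<subseteq> E" by auto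
  obtain B c where B: "B \<subseteq> S" "card B + card V = card S + card (components V S ends)"
    and Bzero: "\<forall>x\<in>flows S. (\<forall>b\<in>B. x b = 0) \<longrightarrow> (\<forall>e. x e = 0)"
    and "\<forall>b\<in>B. c b \<in> flows S \<and> (\<forall>b'\<in>B. c b b' = of_bool (b = b'))"
    using insert.IH[OF e(2)] by (elim exE conjE) (rule that; assumption)
  then have c: "\<And>b. b \<in> B \<Longrightarrow> c b \<in> flows S"
      "\<And>b b'. b \<in> B \<Longrightarrow> b' \<in> B \<Longrightarrow> c b b' = of_bool (b = b')"
    by blast+
  have c': "c b \<in> flows (insert e S)" if "b \<in> B" for b
    using c(1)[OF that] flows_mono[of S "insert e S"] by blast
  have finB: "finite B" using B(1) insert.hyps(1) by (rule finite_subset)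
  have restrict: "x \<in> flows S" if "x \<in> flows (insert e S)" "x e = 0" for x
    using that by (auto simp: flows_def)
  show ?case
  proof (cases "(h e, t e) \<in> linked S")
    case True
    then obtain c0 where c0: "c0 \<in> flows (insert e S)" "c0 e = 1"
      using flow_through_edge[OF _ e(2) e(1) insert.hyps(2)] by (auto simp: linked_def)
    \<comment> \<open>Clearing the coordinates in \<open>B\<close> keeps the system dual to the enlarged coordinate set.\<close>
    define ce where "ce = (\<lambda>e'. c0 e' - (\<Sum>b\<in>B. c0 b * c b e'))"
    have "ce \<in> flows (insert e S)" unfolding ce_def
      by (intro flows_diff c0 flows_sum flows_cmult c')
    moreover have "ce b = 0" if "b \<in> B" for b
    proof -
      have "(\<Sum>b'\<in>B. c0 b' * c b' b) = (\<Sum>b'\<in>B. if b' = b then c0 b' else 0)"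
        using c(2) that by (intro sum.cong) auto
      then show ?thesis using that finB by (simp add: ce_def)
    qed
    moreover have cbe: "c b e = 0" if "b \<in> B" for b
      using c(1)[OF that] insert.hyps(2) by (simp add: flows_def)
    then have "ce e = 1" using c0 by (simp add: ce_def)
    moreover have "e \<notin> B" using B(1) insert.hyps(2) by auto
    ultimately have ex: "\<forall>b\<in>insert e B. (c(e := ce)) b \<in> flows (insert e S) \<and>
      (\<forall>b'\<in>insert e B. (c(e := ce)) b b' = of_bool (b = b'))"
      using c' c(2) cbe by auto
    show ?thesis
    proof (intro exI[of _ "insert e B"] conjI exI[of _ "c(e := ce)"] ballI impI allI)
      show "card (insert e B) + card V = card (insert e S) + card (components V (insert e S) ends)"
        using B(2) components_insert_linked[OF e True] \<open>e \<notin> B\<close> finB insert.hyps by simp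
      show "insert e B \<subseteq> insert e S" using B(1) by auto
      show "x e' = 0" if "x \<in> flows (insert e S)" "\<forall>b\<in>insert e B. x b = 0" for x e'
        by (rule Bzero[rule_format, OF restrict[OF that(1)]]) (use that(2) in auto)
    qed (use ex in blast)+
  next
    case False
    have x0: "x e = 0" if "x \<in> flows (insert e S)" for x
      using flow_on_separating_edge[OF _ e(2,1) that] False h_in_V[OF e(1)] t_in_V[OF e(1)]
      by (auto simp: linked_def)
    show ?thesis
    proof (intro exI[of _ B] conjI exI[of _ c] ballI impI allI)
      show "card B + card V = card (insert e S) + card (components V (insert e S) ends)"
        using B(2) card_components_insert_unlinked[OF e False] insert.hyps by simp
      show "B \<subseteq> insert e S" using B(1) by auto
      show "x e' = 0" if "x \<in> flows (insert e S)" "\<forall>b\<in>B. x b = 0" for x e'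
        by (rule Bzero[rule_format, OF restrict[OF that(1) x0[OF that(1)]]]) (use that(2) in auto)
    qed (use c c' in blast)+
  qed
qed

lemma bridgeless_flow_through_edge:
  assumes "bridgeless V E ends" "e \<in> E"
  shows "\<exists>c\<in>flows E. c e = 1"
proof -
  have E: "insert e (E - {e}) = E" using assms(2) by auto
  have "(h e, t e) \<in> linked (E - {e})"
  proof (rule ccontr)
    assume "(h e, t e) \<notin> linked (E - {e})"
    from card_components_insert_unlinked[OF assms(2) _ this] have "is_bridge V E ends e"
      using assms(2) unfolding E is_bridge_def by auto
    with assms(1) show False by (auto simp: bridgeless_def)
  qed
  then show ?thesis using flow_through_edge[of e "E - {e}"] assms(2) unfolding E
    by (auto simp: linked_def)
qed

lemma nowhere_zero_flow:
  assumes "bridgeless V E ends"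
  shows "\<exists>z\<in>flows E. \<forall>e\<in>E. z e \<noteq> 0"
proof -
  have "\<exists>z\<in>flows E. \<forall>e\<in>K. z e \<noteq> 0" if "K \<subseteq> E" for K
    using finite_subset[OF that finite_E] that
  proof (induction K rule: finite_induct)
    case empty
    have "(\<lambda>_. 0) \<in> flows E" by (simp add: flows_def excess_def)
    then show ?case by blast
  next
    case (insert e K)
    then obtain z where z: "z \<in> flows E" "\<And>e. e \<in> K \<Longrightarrow> z e \<noteq> 0" by auto
    obtain c where c: "c \<in> flows E" "c e = 1"
      using bridgeless_flow_through_edge[OF assms, of e] insert.prems by auto
    show ?case
    proof (cases "z e = 0")
      case False
      with z show ?thesis by auto
    next
      case True
      \<comment> \<open>The multiple of \<open>z\<close> dominates \<open>c\<close> on \<open>K\<close>, so that adding \<open>c\<close> cannot cancel a coordinate there.\<close>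
      define m where "m = 1 + (\<Sum>e\<in>K. \<bar>c e\<bar>)"
      have "m * z e' + c e' \<noteq> 0" if "e' \<in> K" for e'
      proof -
        have "\<bar>c e'\<bar> \<le> (\<Sum>e\<in>K. \<bar>c e\<bar>)"
          using that insert.hyps(1) by (intro member_le_sum) auto
        then have lt: "\<bar>c e'\<bar> < m * 1" by (simp add: m_def)
        also have "m * 1 \<le> m * \<bar>z e'\<bar>"
          using z(2)[OF that] lt by (intro mult_left_mono) auto
        also have "\<dots> = \<bar>m * z e'\<bar>" using lt by (simp add: abs_mult)
        finally show ?thesis by linarith
      qed
      moreover have "m * z e + c e \<noteq> 0" using True c by simp
      moreover have "(\<lambda>e'. m * z e' + c e') \<in> flows E"
        by (intro flows_add flows_cmult z c)
      ultimately show ?thesis by (intro bexI[of _ "\<lambda>e'. m * z e' + c e'"]) auto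
    qed
  qed
  from this[of E] show ?thesis by simp
qed

definition nz_flows :: "('e \<Rightarrow> int) \<Rightarrow> ('e \<Rightarrow> int) set" where
  "nz_flows k = {x \<in> flows E. \<forall>e\<in>E. x e \<noteq> 0 \<and> \<bar>x e\<bar> < k e}"

lemma flow_count_eq_card_nz_flows: "flow_count V E h t k = card (nz_flows k)"
proof -
  have ex: "excess x v = (\<Sum>e\<in>{e\<in>E. h e = v}. x e) - (\<Sum>e\<in>{e\<in>E. t e = v}. x e)" for x v
  proof -
    have "excess x v = (\<Sum>e\<in>E. (if h e = v then x e else 0) - (if t e = v then x e else 0))"
      unfolding excess_def by (rule sum.cong) auto
    then show ?thesis using finite_E by (simp add: sum_subtractf sum.inter_filter[symmetric])
  qed
  have ex0: "excess x v = 0" if "v \<notin> V" for x v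
    unfolding excess_def using that h_in_V t_in_V by (intro sum.neutral) (auto simp: of_bool_def)
  have exr: "excess (restrict x E) v = excess x v" for x v by (simp add: excess_def)
  have exr': "excess (\<lambda>e. if e \<in> E then x e else 0) v = excess x v" for x v by (simp add: excess_def)
  have "bij_betw (\<lambda>x. restrict x E) (nz_flows k) (nowhere_zero_k_flows V E h t k)"
  proof (rule bij_betw_byWitness[where f' = "\<lambda>x e. if e \<in> E then x e else 0"])
    show "\<forall>x\<in>nz_flows k. (\<lambda>e. if e \<in> E then restrict x E e else 0) = x"
      by (auto simp: nz_flows_def flows_def fun_eq_iff)
    show "\<forall>x\<in>nowhere_zero_k_flows V E h t k. (\<lambda>e\<in>E. if e \<in> E then x e else 0) = x"
      by (auto simp: nowhere_zero_k_flows_def integral_flows_def fun_eq_iff restrict_def PiE_def extensional_def)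
    have "(\<Sum>e\<in>{e\<in>E. h e = v}. restrict x E e) = (\<Sum>e\<in>{e\<in>E. t e = v}. restrict x E e)"
      if "x \<in> nz_flows k" for x v
      using that ex[of "restrict x E" v] exr[of x v] by (simp add: nz_flows_def flows_def)
    then show "(\<lambda>x. restrict x E) ` nz_flows k \<subseteq> nowhere_zero_k_flows V E h t k"
      by (auto simp: nowhere_zero_k_flows_def integral_flows_def nz_flows_def)
    have "excess (\<lambda>e. if e \<in> E then x e else 0) v = 0"
      if "x \<in> nowhere_zero_k_flows V E h t k" for x v
      using that ex[of x v] ex0[of v] unfolding exr'
      by (cases "v \<in> V") (auto simp: nowhere_zero_k_flows_def integral_flows_def)
    then show "(\<lambda>x e. if e \<in> E then x e else 0) ` nowhere_zero_k_flows V E h t k \<subseteq> nz_flows k"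
      by (auto simp: nz_flows_def flows_def nowhere_zero_k_flows_def)
  qed
  then show ?thesis unfolding flow_count_def by (rule bij_betw_same_card[symmetric])
qed

lemma finite_bounded_flows: "finite {x \<in> flows E. \<forall>e\<in>E. \<bar>x e\<bar> \<le> b e}"
proof (rule finite_subset)
  show "{x \<in> flows E. \<forall>e\<in>E. \<bar>x e\<bar> \<le> b e} \<subseteq>
      (\<lambda>y e. if e \<in> E then y e else 0) ` (\<Pi>\<^sub>E e\<in>E. {- b e..b e})"
  proof
    fix x assume x: "x \<in> {x \<in> flows E. \<forall>e\<in>E. \<bar>x e\<bar> \<le> b e}"
    then have "x = (\<lambda>e. if e \<in> E then restrict x E e else 0)"
      by (auto simp: flows_def fun_eq_iff)
    moreover have "restrict x E \<in> (\<Pi>\<^sub>E e\<in>E. {- b e..b e})"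
      using x by (auto simp: abs_le_iff minus_le_iff)
    ultimately show "x \<in> (\<lambda>y e. if e \<in> E then y e else 0) ` (\<Pi>\<^sub>E e\<in>E. {- b e..b e})"
      by blast
  qed
qed (intro finite_imageI finite_PiE finite_E, simp)

lemma finite_nz_flows: "finite (nz_flows k)"
  by (rule finite_subset[OF _ finite_bounded_flows[of k]]) (auto simp: nz_flows_def intro: less_imp_le)

text \<open>
  The fundamental coordinates of a flow determine it, which bounds the count from above. For the lower bound,
  a large multiple of a nowhere-zero flow stays nowhere-zero after adding any combination of fundamental
  flows with small coefficients.
\<close>

lemma card_nz_flows_growth:
  assumes "bridgeless V E ends"
  shows "\<exists>T\<ge>1. \<forall>q\<ge>1. (\<forall>k. (\<forall>e\<in>E. int (q * T) \<le> k e) \<longrightarrow> q ^ cyclomatic_number V E ends \<le> card (nz_flows k)) \<and>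
    (\<forall>k m. (\<forall>e\<in>E. k e \<le> int (q * m)) \<longrightarrow> card (nz_flows k) \<le> (q * (2 * m + 1)) ^ cyclomatic_number V E ends)"
proof -
  obtain B c where B: "B \<subseteq> E" "card B + card V = card E + card (components V E ends)"
    and Bzero: "\<forall>x\<in>flows E. (\<forall>b\<in>B. x b = 0) \<longrightarrow> (\<forall>e. x e = 0)"
    and "\<forall>b\<in>B. c b \<in> flows E \<and> (\<forall>b'\<in>B. c b b' = of_bool (b = b'))"
    using fundamental_flows[OF order_refl] by (elim exE conjE) (rule that; assumption)
  then have c: "\<And>b. b \<in> B \<Longrightarrow> c b \<in> flows E"
      "\<And>b b'. b \<in> B \<Longrightarrow> b' \<in> B \<Longrightarrow> c b b' = of_bool (b = b')"
    by blast+
  have xi: "cyclomatic_number V E ends = card B" using B(2) by (simp add: cyclomatic_number_def)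
  have finB: "finite B" using B(1) finite_E by (rule finite_subset)
  obtain z where z: "z \<in> flows E" "\<And>e. e \<in> E \<Longrightarrow> z e \<noteq> 0" using nowhere_zero_flow[OF assms] by auto
  define N where "N = (\<Sum>e\<in>E. \<Sum>b\<in>B. nat \<bar>c b e\<bar>)"
  define Z where "Z = (\<Sum>e\<in>E. nat \<bar>z e\<bar>)"
  define T where "T = (N + 1) * (Z + 1)"
  have cN: "(\<Sum>b\<in>B. \<bar>c b e\<bar>) \<le> int N" if "e \<in> E" for e
  proof -
    have "(\<Sum>b\<in>B. nat \<bar>c b e\<bar>) \<le> N" unfolding N_def
      using that finite_E by (intro member_le_sum) auto
    moreover have "(\<Sum>b\<in>B. \<bar>c b e\<bar>) = int (\<Sum>b\<in>B. nat \<bar>c b e\<bar>)" by simp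
    ultimately show ?thesis by linarith
  qed
  have zZ: "\<bar>z e\<bar> \<le> int Z" if "e \<in> E" for e
  proof -
    have "nat \<bar>z e\<bar> \<le> Z" unfolding Z_def using that finite_E by (intro member_le_sum) auto
    then show ?thesis by linarith
  qed
  have "q ^ card B \<le> card (nz_flows k)" if q: "q \<ge> 1" and k: "\<forall>e\<in>E. int (q * T) \<le> k e" for q k
  proof -
    \<comment> \<open>The combination of fundamental flows is at most \<open>N * q\<close> on each edge, less than the multiple of \<open>z\<close>; the coordinates in \<open>B\<close> recover \<open>y\<close>.\<close>
    define F where "F = (\<lambda>y e. int ((N + 1) * q) * z e + (\<Sum>b\<in>B. y b * c b e))"
    have inj: "inj_on F (\<Pi>\<^sub>E b\<in>B. {0..<int q})"
    proof (rule inj_onI)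
      fix y y' assume y: "y \<in> (\<Pi>\<^sub>E b\<in>B. {0..<int q})" "y' \<in> (\<Pi>\<^sub>E b\<in>B. {0..<int q})" "F y = F y'"
      have Fb: "F y b = int ((N + 1) * q) * z b + y b" if "b \<in> B" for y b
      proof -
        have "(\<Sum>b'\<in>B. y b' * c b' b) = (\<Sum>b'\<in>B. if b' = b then y b' else 0)"
          using c(2) that by (intro sum.cong) auto
        then show ?thesis using that finB by (simp add: F_def)
      qed
      have "y b = y' b" if "b \<in> B" for b
        using Fb[OF that, of y] Fb[OF that, of y'] y(3) by simp
      then show "y = y'" using y(1,2) by (intro PiE_ext) auto
    qed
    have "F ` (\<Pi>\<^sub>E b\<in>B. {0..<int q}) \<subseteq> nz_flows k"
    proof
      fix x assume "x \<in> F ` (\<Pi>\<^sub>E b\<in>B. {0..<int q})"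
      then obtain y where y: "y \<in> (\<Pi>\<^sub>E b\<in>B. {0..<int q})" "x = F y" by auto
      have "x \<in> flows E" unfolding y(2) F_def
        by (intro flows_add flows_cmult flows_sum z c)
      moreover have "x e \<noteq> 0 \<and> \<bar>x e\<bar> < k e" if e: "e \<in> E" for e
      proof -
        define r where "r = (\<Sum>b\<in>B. y b * c b e)"
        have "\<bar>r\<bar> \<le> (\<Sum>b\<in>B. \<bar>y b * c b e\<bar>)" unfolding r_def by (rule sum_abs)
        also have "\<dots> \<le> (\<Sum>b\<in>B. int q * \<bar>c b e\<bar>)"
          using y(1) by (intro sum_mono) (auto simp: abs_mult PiE_iff less_imp_le intro!: mult_right_mono)
        also have "\<dots> \<le> int q * int N"
          unfolding sum_distrib_left[symmetric] by (intro mult_left_mono cN e) auto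
        finally have r: "\<bar>r\<bar> \<le> int q * int N" .
        have x: "x e = int ((N + 1) * q) * z e + r" by (simp add: y(2) F_def r_def)
        have abs: "\<bar>int ((N + 1) * q) * z e\<bar> = int ((N + 1) * q) * \<bar>z e\<bar>"
          by (simp only: abs_mult abs_of_nat)
        have "int ((N + 1) * q) * 1 \<le> int ((N + 1) * q) * \<bar>z e\<bar>"
          using z(2)[OF e] by (intro mult_left_mono) auto
        then have low: "int q * int N + int q \<le> \<bar>int ((N + 1) * q) * z e\<bar>"
          unfolding abs by (simp add: algebra_simps)
        have "int ((N + 1) * q) * \<bar>z e\<bar> \<le> int ((N + 1) * q) * int Z"
          by (intro mult_left_mono zZ e) auto
        then have up: "\<bar>int ((N + 1) * q) * z e\<bar> + int q * int N + int q \<le> int (q * T)"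
          unfolding abs by (simp add: T_def algebra_simps)
        have "int q \<ge> 1" using q by simp
        moreover have "int (q * T) \<le> k e" using k e by blast
        ultimately show ?thesis using r low up unfolding x by linarith
      qed
      ultimately show "x \<in> nz_flows k" by (simp add: nz_flows_def)
    qed
    then have "card (F ` (\<Pi>\<^sub>E b\<in>B. {0..<int q})) \<le> card (nz_flows k)"
      by (rule card_mono[OF finite_nz_flows])
    then show ?thesis using finB by (simp add: card_image[OF inj] card_PiE)
  qed
  moreover have tmp: "card (nz_flows k) \<le> (q * (2 * m + 1)) ^ card B"
    if q: "q \<ge> 1" and k: "\<forall>e\<in>E. k e \<le> int (q * m)" for q k m
  proof -
    have inj: "inj_on (\<lambda>x. restrict x B) (nz_flows k)"
    proof (rule inj_onI)
      fix x y assume xy: "x \<in> nz_flows k" "y \<in> nz_flows k" "restrict x B = restrict y B"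
      have "x e - y e = 0" for e
      proof (rule Bzero[rule_format, of "\<lambda>e. x e - y e"])
        show "(\<lambda>e. x e - y e) \<in> flows E" using xy by (intro flows_diff) (auto simp: nz_flows_def)
        show "x b - y b = 0" if "b \<in> B" for b using fun_cong[OF xy(3), of b] that by simp
      qed
      then show "x = y" by auto
    qed
    have "(\<lambda>x. restrict x B) ` nz_flows k \<subseteq> (\<Pi>\<^sub>E b\<in>B. {- int (q * m)..int (q * m)})"
    proof (intro subsetI, elim imageE)
      fix x y assume xy: "x \<in> nz_flows k" "y = restrict x B"
      have "\<bar>x b\<bar> \<le> int (q * m)" if "b \<in> B" for b
        using xy(1) k that B(1) by (force simp: nz_flows_def)
      then show "y \<in> (\<Pi>\<^sub>E b\<in>B. {- int (q * m)..int (q * m)})"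
        unfolding xy(2) by (auto simp: abs_le_iff minus_le_iff)
    qed
    then have "card ((\<lambda>x. restrict x B) ` nz_flows k) \<le> card (\<Pi>\<^sub>E b\<in>B. {- int (q * m)..int (q * m)})"
      using finB by (intro card_mono finite_PiE) auto
    also have "card (\<Pi>\<^sub>E b\<in>B. {- int (q * m)..int (q * m)}) = (2 * (q * m) + 1) ^ card B"
    proof -
      have "card {- int (q * m)..int (q * m)} = 2 * (q * m) + 1"
        by (simp only: card_atLeastAtMost_int)
      then show ?thesis using finB by (simp only: card_PiE prod_constant)
    qed
    also have "\<dots> \<le> (q * (2 * m + 1)) ^ card B"
      using q by (intro power_mono) (auto simp: algebra_simps)
    finally show ?thesis by (simp add: card_image[OF inj])
  qed
  ultimately show ?thesis unfolding xi by (intro exI[of _ T]) (auto simp: T_def)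
qed

end

section \<open>The closed cones of an arrangement\<close>

text \<open>
  Finitely many hyperplanes do not cover the positive orthant.
\<close>

lemma generic_positive_vector:
  assumes "finite I" "finite W" "\<And>l. l \<in> W \<Longrightarrow> \<exists>i\<in>I. l i \<noteq> 0"
  shows "\<exists>v. (\<forall>i. v i > 0) \<and> (\<forall>l\<in>W. lin I l v \<noteq> 0)"
  using assms(2,3)
proof (induction W rule: finite_induct)
  case empty
  show ?case by (intro exI[of _ "\<lambda>_. 1"]) simp
next
  case (insert l W)
  then obtain v where v: "\<And>i. v i > 0" "\<And>l. l \<in> W \<Longrightarrow> lin I l v \<noteq> 0" by auto
  show ?case
  proof (cases "lin I l v = 0")
    case False
    with v show ?thesis by auto
  next
    case True
    obtain i where i: "i \<in> I" "l i \<noteq> 0" using insert.prems by auto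
    define s where "s = (\<lambda>l. sgn (lin I l v))"
    have s0: "s l \<noteq> 0" if "l \<in> W" for l using v(2)[OF that] by (simp add: s_def sgn_0_0)
    have "v \<in> chamber I W s" by (simp add: chamber_def s_def)
    then obtain e where e: "e > 0" "\<And>b. (\<forall>i\<in>I. \<bar>b i - v i\<bar> < e) \<Longrightarrow> b \<in> chamber I W s"
      using chamber_open[OF insert.hyps(1) assms(1) s0 \<open>v \<in> chamber I W s\<close>] by blast
    \<comment> \<open>A step along \<open>i\<close> that is short enough to keep the signs of the functionals treated before.\<close>
    define u where "u = (\<lambda>j. if j = i then e / 2 else 0)"
    have lu: "lin I l' u = of_int (l' i) * (e / 2)" for l'
    proof -
      have "lin I l' u = (\<Sum>j\<in>I. if j = i then of_int (l' i) * (e / 2) else 0)"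
        unfolding lin_def u_def by (rule sum.cong) auto
      then show ?thesis using i(1) assms(1) by simp
    qed
    have "(\<lambda>j. v j + u j) \<in> chamber I W s" using e(1) by (intro e(2)) (auto simp: u_def)
    then have "lin I l' (\<lambda>j. v j + u j) \<noteq> 0" if "l' \<in> W" for l'
      using v(2)[OF that] that by (fastforce simp: chamber_def s_def sgn_if split: if_splits)
    moreover have "lin I l (\<lambda>j. v j + u j) \<noteq> 0" using True e(1) i(2) by (simp add: lin_add lu)
    moreover have "v j + u j > 0" for j using v(1)[of j] e(1) by (auto simp: u_def intro: add_pos_pos)
    ultimately show ?thesis by (intro exI[of _ "\<lambda>j. v j + u j"]) auto
  qed
qed

lemma eventually_small_multiple:
  fixes a b :: real
  assumes "0 < b" shows "\<forall>\<^sub>F t in at_right 0. t * a < b"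
proof -
  have "((\<lambda>t. t * a) \<longlongrightarrow> 0 * a) (at_right 0)" by (intro tendsto_intros)
  then show ?thesis using assms by (auto dest: order_tendstoD(2))
qed

text \<open>
  A sign vector is encoded by the set of functionals that are positive on the chamber. This makes the set
  of all chambers visibly finite.
\<close>

definition side :: "('i \<Rightarrow> int) set \<Rightarrow> ('i \<Rightarrow> int) \<Rightarrow> real" where
  "side X l = (if l \<in> X then 1 else -1)"

lemma side_nonzero: "side X l \<noteq> 0"
  by (simp add: side_def)

definition closed_cone :: "'i set \<Rightarrow> ('i \<Rightarrow> int) set \<Rightarrow> ('i \<Rightarrow> int) set \<Rightarrow> ('i \<Rightarrow> real) set" where
  "closed_cone I M X = {x \<in> I \<rightarrow>\<^sub>E UNIV. \<forall>l\<in>M. 0 \<le> side X l * lin I l x}"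

definition unit_functional :: "'i \<Rightarrow> 'i \<Rightarrow> int" where
  "unit_functional i = (\<lambda>j. of_bool (j = i))"

lemma lin_unit_functional:
  assumes "finite I" "i \<in> I" shows "lin I (unit_functional i) x = x i"
proof -
  have "lin I (unit_functional i) x = (\<Sum>j\<in>I. if j = i then x j else 0)"
    unfolding lin_def unit_functional_def by (rule sum.cong) auto
  then show ?thesis using assms by simp
qed

lemma rational_closed_cone:
  assumes "finite M" shows "rational_polyhedral_cone I (closed_cone I M X)"
proof -
  define nv where "nv = (\<lambda>l i. rat_of_int (if l \<in> X then l i else - l i))"
  have "(\<Sum>i\<in>I. of_rat (nv l i) * x i) = side X l * lin I l x" for l x
    by (simp add: nv_def side_def lin_def sum_negf of_rat_minus)
  then have "closed_cone I M X = {x \<in> I \<rightarrow>\<^sub>E UNIV. \<forall>a\<in>nv ` M. 0 \<le> (\<Sum>i\<in>I. of_rat (a i) * x i)}"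
    by (simp add: closed_cone_def)
  with assms show ?thesis unfolding rational_polyhedral_cone_def
    by (intro exI[of _ "nv ` M"]) simp
qed

lemma chamber_subset_closed_cone:
  assumes "x \<in> chamber I M (side X)" shows "restrict x I \<in> closed_cone I M X"
proof -
  have "0 \<le> side X l * lin I l (restrict x I)" if "l \<in> M" for l
  proof -
    have "lin I l (restrict x I) = lin I l x" by (rule lin_cong) simp
    moreover have "sgn (lin I l x) = side X l" using assms that by (simp add: chamber_def)
    ultimately show ?thesis by (auto simp: side_def sgn_if split: if_splits)
  qed
  then show ?thesis by (simp add: closed_cone_def)
qed

text \<open>
  For a point \<open>w\<close> of the open chamber and a small \<open>r\<close>, the vector \<open>y\<close> is a multiple of the difference
  of the two points \<open>w + r y\<close> and \<open>w\<close> of the cone.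
\<close>

lemma full_dimensional_closed_cone:
  assumes "finite I" "finite M" "chamber I M (side X) \<noteq> {}"
  shows "full_dimensional I (closed_cone I M X)"
  unfolding full_dimensional_def
proof
  fix y :: "'a \<Rightarrow> real"
  obtain w where w: "w \<in> chamber I M (side X)" using assms(3) by auto
  obtain e where e: "e > 0" "\<And>b. (\<forall>i\<in>I. \<bar>b i - w i\<bar> < e) \<Longrightarrow> b \<in> chamber I M (side X)"
    using chamber_open[OF assms(2,1) side_nonzero w] by blast
  define m where "m = (\<Sum>i\<in>I. \<bar>y i\<bar>)"
  have m: "m \<ge> 0" "\<And>i. i \<in> I \<Longrightarrow> \<bar>y i\<bar> \<le> m"
    using assms(1) by (auto simp: m_def sum_nonneg intro: member_le_sum)
  define r where "r = e / (m + 1)"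
  have r: "r > 0" "r * (m + 1) = e" using m e by (auto simp: r_def)
  define P Q where "P = (\<lambda>i\<in>I. w i + r * y i)" and "Q = restrict w I"
  have "(\<lambda>i. w i + r * y i) \<in> chamber I M (side X)"
  proof (rule e(2), intro ballI)
    fix i assume "i \<in> I"
    have "\<bar>w i + r * y i - w i\<bar> = r * \<bar>y i\<bar>" using r by (simp add: abs_mult)
    also have "\<dots> \<le> r * m" using m(2)[OF \<open>i \<in> I\<close>] r by simp
    also have "\<dots> < e" using r by (simp add: algebra_simps)
    finally show "\<bar>w i + r * y i - w i\<bar> < e" .
  qed
  then have PQ: "P \<in> closed_cone I M X" "Q \<in> closed_cone I M X"
    using chamber_subset_closed_cone w by (auto simp: P_def Q_def)
  show "\<exists>S c. finite S \<and> S \<subseteq> closed_cone I M X \<and> (\<forall>e\<in>I. y e = (\<Sum>s\<in>S. c s * s e))"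
  proof (cases "P = Q")
    case True
    have "y i = 0" if "i \<in> I" for i
      using fun_cong[OF True, of i] that r by (simp add: P_def Q_def)
    then show ?thesis by (intro exI[of _ "{}"]) auto
  next
    case False
    have "y i = (\<Sum>s\<in>{P, Q}. (if s = P then 1 / r else - 1 / r) * s i)" if "i \<in> I" for i
      using False that r by (simp add: P_def Q_def field_simps)
    with PQ show ?thesis
      by (intro exI[of _ "{P, Q}"] exI[of _ "\<lambda>s. if s = P then 1 / r else - 1 / r"]) auto
  qed
qed

text \<open>
  Pushing a point of the orthant a little in a generic positive direction leads into an open
  chamber, and the signs that were nonzero before do not change. So the point lies in the closure of
  a chamber with interior points, and lower-dimensional cones can be left out of the union.
\<close>

lemma closed_cones_cover_orthant:
  assumes "finite I" "finite M" and M: "\<And>l. l \<in> M \<Longrightarrow> \<exists>i\<in>I. l i \<noteq> 0"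
    and units: "\<And>i. i \<in> I \<Longrightarrow> unit_functional i \<in> M"
  shows "(\<Union>X\<in>{X \<in> Pow M. unit_functional ` I \<subseteq> X \<and> chamber I M (side X) \<noteq> {}}. closed_cone I M X)
    = (I \<rightarrow>\<^sub>E {0..})" (is "(\<Union>X\<in>?Xs. _) = _")
proof
  show "(\<Union>X\<in>?Xs. closed_cone I M X) \<subseteq> (I \<rightarrow>\<^sub>E {0..})"
  proof (intro UN_least subsetI)
    fix X x assume X: "X \<in> ?Xs" and x: "x \<in> closed_cone I M X"
    have "0 \<le> x i" if "i \<in> I" for i
    proof -
      have "side X (unit_functional i) = 1" using X that by (auto simp: side_def)
      moreover have "0 \<le> side X (unit_functional i) * lin I (unit_functional i) x"
        using x units[OF that] by (simp add: closed_cone_def)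
      ultimately show ?thesis using lin_unit_functional[OF assms(1) that] by simp
    qed
    then show "x \<in> I \<rightarrow>\<^sub>E {0..}" using x by (auto simp: closed_cone_def PiE_iff)
  qed
  show "(I \<rightarrow>\<^sub>E {0..}) \<subseteq> (\<Union>X\<in>?Xs. closed_cone I M X)"
  proof
    fix x :: "'a \<Rightarrow> real" assume x: "x \<in> I \<rightarrow>\<^sub>E {0..}"
    obtain v where v: "\<And>i. v i > 0" "\<And>l. l \<in> M \<Longrightarrow> lin I l v \<noteq> 0"
      using generic_positive_vector[OF assms(1,2) M] by auto
    have "\<forall>\<^sub>F t in at_right 0. \<forall>l\<in>M. lin I l x \<noteq> 0 \<longrightarrow> t * \<bar>lin I l v\<bar> < \<bar>lin I l x\<bar>"
    proof (rule eventually_ball_finite[OF assms(2)], intro ballI)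
      fix l
      show "\<forall>\<^sub>F t in at_right 0. lin I l x \<noteq> 0 \<longrightarrow> t * \<bar>lin I l v\<bar> < \<bar>lin I l x\<bar>"
        using eventually_small_multiple[of "\<bar>lin I l x\<bar>" "\<bar>lin I l v\<bar>"]
        by (cases "lin I l x = 0") (auto elim: eventually_mono)
    qed
    moreover have "\<forall>\<^sub>F t in at_right (0::real). 0 < t" by (rule eventually_at_right_less)
    ultimately have "\<forall>\<^sub>F t in at_right 0. 0 < t \<and>
        (\<forall>l\<in>M. lin I l x \<noteq> 0 \<longrightarrow> t * \<bar>lin I l v\<bar> < \<bar>lin I l x\<bar>)"
      by eventually_elim simp
    then obtain t where t: "0 < t" "\<And>l. l \<in> M \<Longrightarrow> lin I l x \<noteq> 0 \<Longrightarrow> t * \<bar>lin I l v\<bar> < \<bar>lin I l x\<bar>"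
      using eventually_happens'[OF trivial_limit_at_right_real] by blast
    define u where "u = (\<lambda>i. x i + t * v i)"
    define X where "X = {l \<in> M. lin I l u > 0}"
    have lu: "lin I l u = lin I l x + t * lin I l v" for l by (simp add: u_def lin_add lin_cmult)
    have abs: "\<bar>t * lin I l v\<bar> = t * \<bar>lin I l v\<bar>" for l using t(1) by (simp add: abs_mult)
    have signs: "sgn (lin I l u) = side X l \<and> 0 \<le> side X l * lin I l x" if "l \<in> M" for l
    proof (cases "lin I l x = 0")
      case True
      then have "lin I l u \<noteq> 0" using lu[of l] t(1) v(2)[OF that] by simp
      then show ?thesis using True that by (auto simp: side_def X_def)
    next
      case False
      then show ?thesis using t(2)[OF that False] abs[of l] lu[of l] that
        by (auto simp: side_def X_def sgn_if)
    qed
    have "u \<in> chamber I M (side X)" using signs by (simp add: chamber_def)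
    moreover have "unit_functional ` I \<subseteq> X"
    proof
      fix l assume "l \<in> unit_functional ` I"
      then obtain i where i: "i \<in> I" "l = unit_functional i" by auto
      have "lin I l u = x i + t * v i" using i lin_unit_functional[OF assms(1) i(1)] by (simp add: u_def)
      moreover have "x i \<ge> 0" using x i by (auto simp: PiE_iff)
      moreover have "t * v i > 0" using t(1) v(1) by simp
      ultimately show "l \<in> X" using units[OF i(1)] i by (simp add: X_def)
    qed
    ultimately have "X \<in> ?Xs" by (auto simp: X_def)
    moreover have "x \<in> closed_cone I M X" using x signs by (auto simp: closed_cone_def PiE_iff)
    ultimately show "x \<in> (\<Union>X\<in>?Xs. closed_cone I M X)" by blast
  qed
qed

section \<open>Piecewise polynomiality of the flow count\<close>

context oriented_multigraph
begin

text \<open>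
  Each edge gives two coordinates, so that upper and lower bounds on a flow both become upper bounds
  on coordinates.
\<close>

definition signed :: "('e \<Rightarrow> int) \<Rightarrow> 'e \<times> bool \<Rightarrow> int" where
  "signed x = (\<lambda>(e, s). if s then x e else - x e)"

lemma inj_signed: "inj signed"
proof (rule injI, rule ext)
  fix x y :: "'e \<Rightarrow> int" and e
  assume "signed x = signed y"
  from fun_cong[OF this, of "(e, True)"] show "x e = y e" by (simp add: signed_def)
qed

lemma unimodular_lattice_flows:
  "unimodular_lattice (E \<times> UNIV) (signed ` flows E)"
proof
  show "finite (E \<times> (UNIV :: bool set))" using finite_E by simp
  show "(\<lambda>i. x i - y i) \<in> signed ` flows E"
    if xy: "x \<in> signed ` flows E" "y \<in> signed ` flows E" for x y
  proof -
    obtain x' y' where "x' \<in> flows E" "y' \<in> flows E" "x = signed x'" "y = signed y'" using xy by blast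
    moreover have "(\<lambda>i. signed x' i - signed y' i) = signed (\<lambda>e. x' e - y' e)"
      by (auto simp: signed_def fun_eq_iff)
    ultimately show ?thesis using flows_diff by auto
  qed
  show "(\<forall>x\<in>signed ` flows E. (\<forall>j\<in>J. x j = 0) \<longrightarrow> x i = 0) \<or>
      (\<exists>c\<in>signed ` flows E. (\<forall>j\<in>J. c j = 0) \<and> c i = 1)"
    if Ji: "J \<subseteq> E \<times> UNIV" "i \<in> E \<times> UNIV" for J i
  proof -
    obtain e s where i: "i = (e, s)" "e \<in> E" using Ji(2) by auto
    define S where "S = E - fst ` J"
    have zero: "x \<in> flows E \<and> (\<forall>j\<in>J. signed x j = 0) \<longleftrightarrow> x \<in> flows S" for x
    proof -
      have "signed x j = 0 \<longleftrightarrow> x (fst j) = 0" for j by (cases j) (simp add: signed_def)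
      then have "(\<forall>j\<in>J. signed x j = 0) \<longleftrightarrow> (\<forall>e\<in>fst ` J. x e = 0)" by simp
      then show ?thesis by (auto simp: S_def flows_def)
    qed
    have "S \<subseteq> E" by (auto simp: S_def)
    from unimodular_flows[OF this i(2)] show ?thesis
    proof
      assume "\<forall>x\<in>flows S. x e = 0"
      then have "\<forall>x\<in>signed ` flows E. (\<forall>j\<in>J. x j = 0) \<longrightarrow> x i = 0"
        using zero by (auto simp: i signed_def)
      then show ?thesis ..
    next
      assume "\<exists>c\<in>flows S. c e = 1"
      then obtain c where c: "c \<in> flows S" "c e = 1" by auto
      define c' where "c' = (\<lambda>e. (if s then 1 else -1) * c e)"
      have "c' \<in> flows S" unfolding c'_def by (rule flows_cmult[OF c(1)])
      moreover have "signed c' i = 1" by (simp add: i signed_def c'_def c(2))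
      ultimately show ?thesis using zero[of c'] by blast
    qed
  qed
  show "finite {x \<in> signed ` flows E. \<forall>i\<in>E \<times> UNIV. x i < b i}" for b
  proof (rule finite_subset)
    show "{x \<in> signed ` flows E. \<forall>i\<in>E \<times> UNIV. x i < b i} \<subseteq>
        signed ` {x \<in> flows E. \<forall>e\<in>E. \<bar>x e\<bar> \<le> max (b (e, True)) (b (e, False))}"
    proof
      fix y assume y: "y \<in> {x \<in> signed ` flows E. \<forall>i\<in>E \<times> UNIV. x i < b i}"
      then obtain x where x: "x \<in> flows E" "y = signed x" by auto
      have bound: "signed x i < b i" if "i \<in> E \<times> UNIV" for i
        using y that unfolding x(2) by blast
      have "\<bar>x e\<bar> \<le> max (b (e, True)) (b (e, False))" if "e \<in> E" for e
      proof -
        have "x e < b (e, True)" "- x e < b (e, False)"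
          using bound[of "(e, True)"] bound[of "(e, False)"] that by (simp_all add: signed_def)
        then show ?thesis by linarith
      qed
      with x show "y \<in> signed ` {x \<in> flows E. \<forall>e\<in>E. \<bar>x e\<bar> \<le> max (b (e, True)) (b (e, False))}"
        by blast
    qed
  qed (rule finite_imageI[OF finite_bounded_flows])
qed

text \<open>
  For flows that are positive on \<open>S\<close> and negative elsewhere: the coordinate with the matching sign is bounded by
  \<open>k e\<close> and the opposite one by 0. The definition is polymorphic because the bounds occur over
  integers, rationals and reals.
\<close>

definition sign_bounds :: "'e set \<Rightarrow> ('e \<Rightarrow> 'a::zero) \<Rightarrow> 'e \<times> bool \<Rightarrow> 'a" where
  "sign_bounds S k = (\<lambda>(e, s). if (e \<in> S) = s then k e else 0)"

lemma card_nz_flows_by_signs: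
  "card (nz_flows k) = (\<Sum>S\<in>Pow E.
     card (unimodular_lattice.points (E \<times> UNIV) (signed ` flows E) {} (sign_bounds S k)))"
proof -
  interpret lat: unimodular_lattice "E \<times> UNIV" "signed ` flows E"
    by (rule unimodular_lattice_flows)
  define F where "F = (\<lambda>S. {x \<in> nz_flows k. {e \<in> E. 0 < x e} = S})"
  have eq: "signed ` F S = lat.points {} (sign_bounds S k)" if "S \<subseteq> E" for S
  proof -
    have *: "x \<in> F S \<longleftrightarrow> x \<in> flows E \<and> (\<forall>i\<in>E \<times> UNIV. signed x i < sign_bounds S k i)" for x
    proof
      assume x: "x \<in> F S"
      show "x \<in> flows E \<and> (\<forall>i\<in>E \<times> UNIV. signed x i < sign_bounds S k i)"
      proof (intro conjI ballI)
        show "x \<in> flows E" using x by (simp add: F_def nz_flows_def)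
        fix i assume "i \<in> E \<times> (UNIV :: bool set)"
        then obtain e s where i: "i = (e, s)" "e \<in> E" by auto
        have "e \<in> S \<longleftrightarrow> 0 < x e" "x e \<noteq> 0" "\<bar>x e\<bar> < k e"
          using x i(2) by (auto simp: F_def nz_flows_def)
        then show "signed x i < sign_bounds S k i"
          by (cases s) (auto simp: i signed_def sign_bounds_def)
      qed
    next
      assume x: "x \<in> flows E \<and> (\<forall>i\<in>E \<times> UNIV. signed x i < sign_bounds S k i)"
      have "x e \<noteq> 0 \<and> \<bar>x e\<bar> < k e \<and> (e \<in> S \<longleftrightarrow> 0 < x e)" if "e \<in> E" for e
      proof -
        have "signed x (e, s) < sign_bounds S k (e, s)" for s
          using x that by simp
        from this[of True] this[of False] show ?thesis
          by (cases "e \<in> S") (simp_all add: signed_def sign_bounds_def)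
      qed
      note e = this
      have nz: "\<forall>e\<in>E. x e \<noteq> 0 \<and> \<bar>x e\<bar> < k e"
        using e[THEN conjunct1] e[THEN conjunct2, THEN conjunct1] by (intro ballI conjI)
      have S: "e \<in> S \<longleftrightarrow> 0 < x e" if "e \<in> E" for e
        by (rule e[OF that, THEN conjunct2, THEN conjunct2])
      have "{e \<in> E. 0 < x e} = S"
      proof (intro equalityI subsetI)
        fix e assume "e \<in> S"
        then show "e \<in> {e \<in> E. 0 < x e}" using S[of e] \<open>S \<subseteq> E\<close> by blast
      qed (use S in blast)
      then show "x \<in> F S" using x nz unfolding F_def nz_flows_def by blast
    qed
    have F: "F S = {x \<in> flows E. \<forall>i\<in>E \<times> UNIV. signed x i < sign_bounds S k i}"
      by (rule set_eqI) (unfold mem_Collect_eq, rule *)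
    have points: "lat.points {} (sign_bounds S k) =
        {y \<in> signed ` flows E. \<forall>i\<in>E \<times> UNIV. y i < sign_bounds S k i}"
      by (simp add: lat.points_def)
    show ?thesis unfolding F points by blast
  qed
  have "nz_flows k = (\<Union>S\<in>Pow E. F S)"
  proof (intro equalityI subsetI)
    fix x assume "x \<in> nz_flows k"
    then have "x \<in> F {e \<in> E. 0 < x e}" by (simp add: F_def)
    then show "x \<in> (\<Union>S\<in>Pow E. F S)" by (rule UN_I[rotated]) simp
  next
    fix x assume "x \<in> (\<Union>S\<in>Pow E. F S)"
    then show "x \<in> nz_flows k" by (simp add: F_def)
  qed
  then have "card (nz_flows k) = card (\<Union>S\<in>Pow E. F S)" by (rule arg_cong)
  also have "\<dots> = (\<Sum>S\<in>Pow E. card (F S))"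
  proof (rule card_UN_disjoint)
    show "\<forall>S\<in>Pow E. finite (F S)" using finite_nz_flows by (auto simp: F_def)
    show "\<forall>S\<in>Pow E. \<forall>S'\<in>Pow E. S \<noteq> S' \<longrightarrow> F S \<inter> F S' = {}" by (auto simp: F_def)
  qed (use finite_E in simp)
  also have "\<dots> = (\<Sum>S\<in>Pow E. card (lat.points {} (sign_bounds S k)))"
  proof (intro sum.cong refl)
    fix S assume "S \<in> Pow E"
    then have "S \<subseteq> E" by simp
    have "card (signed ` F S) = card (F S)"
      by (rule card_image[OF inj_on_subset[OF inj_signed subset_UNIV]])
    then show "card (F S) = card (lat.points {} (sign_bounds S k))"
      unfolding eq[OF \<open>S \<subseteq> E\<close>] by (rule sym)
  qed
  finally show ?thesis .
qed

text \<open>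
  The pullback of a functional along \<open>sign_bounds S\<close>. It can be zero although \<open>l\<close> is not.
\<close>

definition pull :: "'e set \<Rightarrow> ('e \<times> bool \<Rightarrow> int) \<Rightarrow> 'e \<Rightarrow> int" where
  "pull S l = (\<lambda>e. l (e, e \<in> S))"

lemma lin_pull: "lin E (pull S l) k = lin (E \<times> UNIV) l (sign_bounds S k)"
proof -
  have "lin (E \<times> UNIV) l (sign_bounds S k) =
      (\<Sum>e\<in>E. \<Sum>s\<in>UNIV. of_int (l (e, s)) * sign_bounds S k (e, s))"
    by (simp add: lin_def sum.cartesian_product split_def)
  also have "\<dots> = (\<Sum>e\<in>E. of_int (l (e, e \<in> S)) * k e)"
    by (intro sum.cong refl) (auto simp: UNIV_bool sign_bounds_def)
  finally show ?thesis by (simp add: lin_def pull_def)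
qed

text \<open>
  A vector \<open>k\<close> on the boundary of a closed cone lies on walls, where the polynomial of a chamber says
  nothing. Because all inequalities are strict, lowering each bound by less than 1 does not change the count: the
  bounds still round up to \<open>sign_bounds S k\<close>. As \<open>k\<close> is positive, there is room to lower the bounds and to
  enter the open chamber at the same time. The chamber reached depends on the cone, the sign
  pattern and the fixed vector \<open>v\<close>, not on \<open>k\<close>.
\<close>

lemma perturbed_bounds:
  fixes k :: "'e \<Rightarrow> int" and w :: "'e \<Rightarrow> real" and v :: "'e \<times> bool \<Rightarrow> real"
  assumes W: "finite W" and k: "\<And>e. e \<in> E \<Longrightarrow> 0 < k e"
    and v: "\<And>i. 0 < v i" "\<And>l. l \<in> W \<Longrightarrow> lin (E \<times> UNIV) l v \<noteq> 0"
    and M: "\<And>l. l \<in> W \<Longrightarrow> (\<exists>e\<in>E. pull S l e \<noteq> 0) \<Longrightarrow> pull S l \<in> M"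
    and w: "w \<in> chamber E M (side X)" "\<And>e. e \<in> E \<Longrightarrow> 0 < w e"
    and kX: "(\<lambda>e\<in>E. real_of_int (k e)) \<in> closed_cone E M X"
  shows "\<exists>a. (\<forall>i\<in>E \<times> UNIV. \<lceil>a i\<rceil> = sign_bounds S k i) \<and>
    a \<in> chamber (E \<times> UNIV) W
      (\<lambda>l. if \<exists>e\<in>E. pull S l e \<noteq> 0 then side X (pull S l) else - sgn (lin (E \<times> UNIV) l v))"
proof -
  let ?k = "\<lambda>e. real_of_int (k e)"
  let ?I = "E \<times> (UNIV :: bool set)"
  have finI: "finite ?I" using finite_E by simp
  have kpos: "0 \<le> side X l * lin E l ?k" if "l \<in> M" for l
  proof -
    have "lin E l (\<lambda>e\<in>E. ?k e) = lin E l ?k" by (rule lin_cong) simp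
    moreover have "0 \<le> side X l * lin E l (\<lambda>e\<in>E. ?k e)" using kX that unfolding closed_cone_def by blast
    ultimately show ?thesis by (simp only:)
  qed
  have wpos: "0 < side X l * lin E l w" if "l \<in> M" for l
    using w(1) that by (auto simp: chamber_def side_def sgn_if split: if_splits)
  have "\<forall>\<^sub>F t in at_right (0::real). \<forall>e\<in>E. t * w e < ?k e"
    by (intro eventually_ball_finite finite_E ballI eventually_small_multiple) (simp add: k)
  moreover have "\<forall>\<^sub>F t in at_right (0::real). \<forall>e\<in>E. t * ?k e < 1 / 2"
    by (intro eventually_ball_finite finite_E ballI eventually_small_multiple) simp
  moreover have "\<forall>\<^sub>F t in at_right (0::real). \<forall>i\<in>?I. t * v i < 1 / 2"
    by (intro eventually_ball_finite finI ballI eventually_small_multiple) simp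
  moreover have "\<forall>\<^sub>F t in at_right (0::real). \<forall>l\<in>W. (\<exists>e\<in>E. pull S l e \<noteq> 0) \<longrightarrow>
      t * (side X (pull S l) * lin ?I l v) < side X (pull S l) * lin E (pull S l) w"
  proof (intro eventually_ball_finite W ballI)
    fix l assume "l \<in> W"
    show "\<forall>\<^sub>F t in at_right (0::real). (\<exists>e\<in>E. pull S l e \<noteq> 0) \<longrightarrow>
      t * (side X (pull S l) * lin ?I l v) < side X (pull S l) * lin E (pull S l) w"
    proof (cases "\<exists>e\<in>E. pull S l e \<noteq> 0")
      case True
      then show ?thesis
        using eventually_small_multiple[OF wpos[OF M[OF \<open>l \<in> W\<close> True]]] by (auto elim: eventually_mono)
    qed auto
  qed
  moreover have "\<forall>\<^sub>F t in at_right (0::real). t * 1 < 1"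
    by (rule eventually_small_multiple) simp
  moreover have "\<forall>\<^sub>F t in at_right (0::real). 0 < t" by (rule eventually_at_right_less)
  ultimately have "\<forall>\<^sub>F t in at_right (0::real). (\<forall>e\<in>E. t * w e < ?k e) \<and>
      (\<forall>e\<in>E. t * ?k e < 1 / 2) \<and> (\<forall>i\<in>?I. t * v i < 1 / 2) \<and>
      (\<forall>l\<in>W. (\<exists>e\<in>E. pull S l e \<noteq> 0) \<longrightarrow>
      t * (side X (pull S l) * lin ?I l v) < side X (pull S l) * lin E (pull S l) w) \<and> t * 1 < 1 \<and> 0 < t"
    by eventually_elim (intro conjI)
  then obtain t where tw: "\<And>e. e \<in> E \<Longrightarrow> t * w e < ?k e"
    and tk: "\<And>e. e \<in> E \<Longrightarrow> t * ?k e < 1 / 2" and tv: "\<And>i. i \<in> ?I \<Longrightarrow> t * v i < 1 / 2"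
    and tl: "\<And>l. l \<in> W \<Longrightarrow> (\<exists>e\<in>E. pull S l e \<noteq> 0) \<Longrightarrow>
      t * (side X (pull S l) * lin ?I l v) < side X (pull S l) * lin E (pull S l) w"
    and t: "t < 1" "0 < t"
    using eventually_happens'[OF trivial_limit_at_right_real] by (smt (verit))
  \<comment> \<open>The linear term lowers the bounds \<open>k e\<close>, the quadratic term moves \<open>k\<close> into the open chamber, and the cubic term in \<open>a\<close> decides the sign of the functionals that vanish on all the bounds of this sign pattern.\<close>
  define k' where "k' = (\<lambda>e. (1 - t) * ?k e + t ^ 2 * w e)"
  define a where "a = (\<lambda>i. sign_bounds S k' i - t ^ 3 * v i)"
  have t3: "0 < t ^ 3 * v i" "t ^ 3 * v i < 1 / 2" if "i \<in> ?I" for i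
  proof -
    show "0 < t ^ 3 * v i" using t v(1) by simp
    have "t ^ 3 \<le> t ^ 1" using t by (intro power_decreasing) auto
    then have "t ^ 3 * v i \<le> t * v i" using v(1)[of i] by (intro mult_right_mono) auto
    with tv[OF that] show "t ^ 3 * v i < 1 / 2" by simp
  qed
  have "\<lceil>a i\<rceil> = sign_bounds S k i" if iI: "i \<in> ?I" for i
  proof -
    obtain e s where i: "i = (e, s)" "e \<in> E" using iI by auto
    show ?thesis
    proof (cases "(e \<in> S) = s")
      case True
      have "t * (t * w e) < t * ?k e" using tw[OF i(2)] t by simp
      moreover have "0 < t * (t * w e)" using t w(2)[OF i(2)] by simp
      ultimately have "k' e \<le> ?k e" "?k e - 1 / 2 < k' e"
        using tk[OF i(2)] by (simp_all add: k'_def power2_eq_square algebra_simps)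
      then have "\<lceil>k' e - t ^ 3 * v i\<rceil> = k e"
        using t3[OF iI] by (intro ceiling_unique) linarith+
      then show ?thesis using True by (simp add: a_def sign_bounds_def i(1))
    next
      case False
      have "\<lceil>- (t ^ 3 * v i)\<rceil> = 0" using t3[OF iI] by (intro ceiling_unique) simp_all
      then show ?thesis using False by (simp add: a_def sign_bounds_def i(1))
    qed
  qed
  moreover have "sgn (lin ?I l a) = (if \<exists>e\<in>E. pull S l e \<noteq> 0 then side X (pull S l) else - sgn (lin ?I l v))"
    if l: "l \<in> W" for l
  proof -
    have la: "lin ?I l a = (1 - t) * lin E (pull S l) ?k + t ^ 2 * lin E (pull S l) w - t ^ 3 * lin ?I l v"
      unfolding a_def lin_diff lin_cmult lin_pull[symmetric] k'_def lin_add ..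
    show ?thesis
    proof (cases "\<exists>e\<in>E. pull S l e \<noteq> 0")
      case True
      let ?s = "side X (pull S l)"
      have "?s * lin ?I l a = (1 - t) * (?s * lin E (pull S l) ?k) +
          t ^ 2 * (?s * lin E (pull S l) w - t * (?s * lin ?I l v))"
        unfolding la by (simp add: algebra_simps power2_eq_square power3_eq_cube)
      moreover have "0 \<le> (1 - t) * (?s * lin E (pull S l) ?k)"
        using t kpos[OF M[OF l True]] by simp
      moreover have "0 < t ^ 2 * (?s * lin E (pull S l) w - t * (?s * lin ?I l v))"
        using t tl[OF l True] by simp
      ultimately have "0 < ?s * lin ?I l a" by linarith
      then have "sgn (lin ?I l a) = ?s" by (auto simp: side_def sgn_if split: if_splits)
      with True show ?thesis by simp
    next
      case False
      then have "lin E (pull S l) x = 0" for x by (auto simp: lin_def)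
      then have "lin ?I l a = - (t ^ 3 * lin ?I l v)" by (simp add: la)
      then have "sgn (lin ?I l a) = - sgn (lin ?I l v)" using t by (simp add: sgn_mult)
      with False show ?thesis by (simp only: if_False)
    qed
  qed
  ultimately show ?thesis by (intro exI[of _ a]) (simp add: chamber_def)
qed

text \<open>
  The walls are the nonzero pullbacks of the walls in the space of bounds, for all sign patterns, together with the
  coordinate functionals, which confine the cones to the positive orthant.
\<close>

lemma nz_flows_piecewise_polynomial:
  "\<exists>M. finite M \<and> (\<forall>l\<in>M. \<exists>e\<in>E. l e \<noteq> 0) \<and> unit_functional ` E \<subseteq> M \<and>
    (\<forall>X. unit_functional ` E \<subseteq> X \<longrightarrow> chamber E M (side X) \<noteq> {} \<longrightarrow>
      (\<exists>d f. polyfn E d f \<and> (\<forall>k. (\<forall>e\<in>E. 0 < k e) \<longrightarrow>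
        (\<lambda>e\<in>E. real_of_int (k e)) \<in> closed_cone E M X \<longrightarrow>
        of_nat (card (nz_flows k)) = f (\<lambda>e. of_int (k e)))))"
proof -
  let ?I = "E \<times> (UNIV :: bool set)"
  interpret lat: unimodular_lattice ?I "signed ` flows E"
    by (rule unimodular_lattice_flows)
  obtain W where W: "finite W" "\<And>l. l \<in> W \<Longrightarrow> \<exists>i\<in>?I. l i \<noteq> 0"
    and Wpoly: "\<And>s. (\<forall>l\<in>W. s l \<noteq> 0) \<Longrightarrow> \<exists>d P. polyfn ?I d P \<and>
      (\<forall>a\<in>chamber ?I W s. of_nat (card (lat.points {} (\<lambda>i. \<lceil>a i\<rceil>))) = P (\<lambda>i. of_int \<lceil>a i\<rceil>))"
    using lat.points_chamberwise_polynomial[of "{}"] by auto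
  have "finite ?I" using finite_E by simp
  from generic_positive_vector[OF this W] obtain v where
    v: "\<And>i. 0 < v i" "\<And>l. l \<in> W \<Longrightarrow> lin ?I l v \<noteq> 0" by blast
  define M where "M = {l \<in> (\<lambda>(S, l). pull S l) ` (Pow E \<times> W). \<exists>e\<in>E. l e \<noteq> 0} \<union> unit_functional ` E"
  have M: "finite M" using finite_E W(1) by (auto simp: M_def)
  have Mnz: "\<forall>l\<in>M. \<exists>e\<in>E. l e \<noteq> 0" by (auto simp: M_def unit_functional_def)
  have units: "unit_functional ` E \<subseteq> M" by (auto simp: M_def)
  have poly: "\<exists>d f. polyfn E d f \<and> (\<forall>k. (\<forall>e\<in>E. 0 < k e) \<longrightarrow>
        (\<lambda>e\<in>E. real_of_int (k e)) \<in> closed_cone E M X \<longrightarrow>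
        of_nat (card (nz_flows k)) = f (\<lambda>e. of_int (k e)))"
    if X: "unit_functional ` E \<subseteq> X" "chamber E M (side X) \<noteq> {}" for X
  proof -
    obtain w where w: "w \<in> chamber E M (side X)" using X(2) by auto
    have wpos: "0 < w e" if "e \<in> E" for e
    proof -
      have "sgn (lin E (unit_functional e) w) = side X (unit_functional e)"
        using w units that by (auto simp: chamber_def)
      then show ?thesis using X(1) that lin_unit_functional[OF finite_E that, of w]
        by (auto simp: side_def sgn_if split: if_splits)
    qed
    have "\<exists>d P. polyfn ?I d P \<and> (\<forall>k. (\<forall>e\<in>E. 0 < k e) \<longrightarrow>
        (\<lambda>e\<in>E. real_of_int (k e)) \<in> closed_cone E M X \<longrightarrow>
        of_nat (card (lat.points {} (sign_bounds S k))) = P (\<lambda>i. of_int (sign_bounds S k i)))"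
      if "S \<subseteq> E" for S
    proof -
      let ?s = "\<lambda>l. if \<exists>e\<in>E. pull S l e \<noteq> 0 then side X (pull S l) else - sgn (lin ?I l v)"
      have "\<forall>l\<in>W. ?s l \<noteq> 0" using v(2) by (simp add: side_nonzero sgn_0_0)
      from Wpoly[OF this] obtain d P where P: "polyfn ?I d P"
        "\<And>a. a \<in> chamber ?I W ?s \<Longrightarrow> of_nat (card (lat.points {} (\<lambda>i. \<lceil>a i\<rceil>))) = P (\<lambda>i. of_int \<lceil>a i\<rceil>)"
        by blast
      have "of_nat (card (lat.points {} (sign_bounds S k))) = P (\<lambda>i. of_int (sign_bounds S k i))"
        if k: "\<forall>e\<in>E. 0 < k e" "(\<lambda>e\<in>E. real_of_int (k e)) \<in> closed_cone E M X" for k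
      proof -
        have "\<exists>a. (\<forall>i\<in>?I. \<lceil>a i\<rceil> = sign_bounds S k i) \<and> a \<in> chamber ?I W ?s"
        proof (rule perturbed_bounds[OF W(1) _ v _ w wpos k(2)])
          show "pull S l \<in> M" if "l \<in> W" "\<exists>e\<in>E. pull S l e \<noteq> 0" for l
            using that \<open>S \<subseteq> E\<close> by (auto simp: M_def)
        qed (use k(1) in auto)
        then obtain a where a: "\<And>i. i \<in> ?I \<Longrightarrow> \<lceil>a i\<rceil> = sign_bounds S k i" "a \<in> chamber ?I W ?s"
          by blast
        have "lat.points {} (\<lambda>i. \<lceil>a i\<rceil>) = lat.points {} (sign_bounds S k)"
          unfolding lat.points_def using a(1) by auto
        moreover have "P (\<lambda>i. of_int \<lceil>a i\<rceil>) = P (\<lambda>i. of_int (sign_bounds S k i))"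
          by (rule polyfn_cong_vars[OF P(1)]) (simp add: a(1))
        ultimately show ?thesis using P(2)[OF a(2)] by simp
      qed
      with P(1) show ?thesis by blast
    qed
    then obtain d P where P: "\<And>S. S \<subseteq> E \<Longrightarrow> polyfn ?I (d S) (P S)"
      "\<And>S k. S \<subseteq> E \<Longrightarrow> (\<forall>e\<in>E. 0 < k e) \<Longrightarrow>
        (\<lambda>e\<in>E. real_of_int (k e)) \<in> closed_cone E M X \<Longrightarrow>
        of_nat (card (lat.points {} (sign_bounds S k))) = P S (\<lambda>i. of_int (sign_bounds S k i))"
      by metis
    define f where "f = (\<lambda>k. \<Sum>S\<in>Pow E. P S (\<lambda>i. sign_bounds S k i))"
    define D where "D = (\<Sum>S\<in>Pow E. d S)"
    have "polyfn E D f" unfolding f_def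
    proof (rule polyfn_sum)
      fix S assume S: "S \<in> Pow E"
      have "polyfn E (d S) (\<lambda>k. P S (\<lambda>i. sign_bounds S k i))"
      proof (rule polyfn_affine_subst[OF P(1)])
        fix i assume "i \<in> ?I"
        then show "polyfn E 1 (\<lambda>k. sign_bounds S k i)"
          using polyfn_var[of "fst i" E 0] polyfn.const[of E 1 0]
          by (cases i; cases "(fst i \<in> S) = snd i") (simp_all add: sign_bounds_def)
      qed (use S in simp)
      moreover have "d S \<le> D" unfolding D_def using S finite_E by (intro member_le_sum) auto
      ultimately show "polyfn E D (\<lambda>k. P S (\<lambda>i. sign_bounds S k i))" by (rule polyfn_mono)
    qed
    moreover have "of_nat (card (nz_flows k)) = f (\<lambda>e. of_int (k e))"
      if k: "\<forall>e\<in>E. 0 < k e" "(\<lambda>e\<in>E. real_of_int (k e)) \<in> closed_cone E M X" for k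
    proof -
      have "rat_of_int (sign_bounds S k i) = sign_bounds S (\<lambda>e. of_int (k e)) i" for S i
        by (cases i) (simp add: sign_bounds_def)
      then show ?thesis
        unfolding card_nz_flows_by_signs f_def of_nat_sum using P(2)[OF _ k] by (intro sum.cong) auto
    qed
    ultimately show ?thesis by blast
  qed
  show ?thesis
    by (rule exI[of _ M]) (intro conjI allI impI M Mnz units poly; assumption)
qed

lemma piecewise_polynomial_flow_count:
  assumes "bridgeless V E ends"
  shows "piecewise_polynomial_of_degree E (\<lambda>k. int (flow_count V E h t k)) (cyclomatic_number V E ends)"
proof -
  define n where "n = cyclomatic_number V E ends"
  obtain M where M_all: "finite M \<and> (\<forall>l\<in>M. \<exists>e\<in>E. l e \<noteq> 0) \<and> unit_functional ` E \<subseteq> M \<and>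
    (\<forall>X. unit_functional ` E \<subseteq> X \<longrightarrow> chamber E M (side X) \<noteq> {} \<longrightarrow>
      (\<exists>d f. polyfn E d f \<and> (\<forall>k. (\<forall>e\<in>E. 0 < k e) \<longrightarrow>
        (\<lambda>e\<in>E. real_of_int (k e)) \<in> closed_cone E M X \<longrightarrow>
        of_nat (card (nz_flows k)) = f (\<lambda>e. of_int (k e)))))"
    using nz_flows_piecewise_polynomial by (rule exE)
  note M = M_all[THEN conjunct1]
    and Mnz = M_all[THEN conjunct2, THEN conjunct1]
    and units_M = M_all[THEN conjunct2, THEN conjunct2, THEN conjunct1]
    and Mpoly = M_all[THEN conjunct2, THEN conjunct2, THEN conjunct2]
  obtain T where T_all: "T \<ge> 1 \<and> (\<forall>q\<ge>1. (\<forall>k. (\<forall>e\<in>E. int (q * T) \<le> k e) \<longrightarrow> q ^ n \<le> card (nz_flows k)) \<and>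
    (\<forall>k m. (\<forall>e\<in>E. k e \<le> int (q * m)) \<longrightarrow> card (nz_flows k) \<le> (q * (2 * m + 1)) ^ n))"
    using card_nz_flows_growth[OF assms, folded n_def] by (rule exE)
  note T = T_all[THEN conjunct1] and card_growth = T_all[THEN conjunct2]
  define Xs where "Xs = {X \<in> Pow M. unit_functional ` E \<subseteq> X \<and> chamber E M (side X) \<noteq> {}}"
  have "finite Xs" using M by (simp add: Xs_def)
  define counts where "counts = (\<lambda>X p. p \<in> polys_over E \<and> has_total_degree p n \<and> (\<forall>k. (\<forall>e\<in>E. 0 < k e) \<longrightarrow>
        (\<lambda>e\<in>E. real_of_int (k e)) \<in> closed_cone E M X \<longrightarrow>
        of_nat (card (nz_flows k)) = eval_mpoly p (\<lambda>e. of_int (k e))))"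
  have "\<exists>p. counts X p" if X: "X \<in> Xs" for X
  proof -
    have units: "unit_functional ` E \<subseteq> X" and ne: "chamber E M (side X) \<noteq> {}"
      using X by (auto simp: Xs_def)
    obtain d0 f where df: "polyfn E d0 f \<and> (\<forall>k. (\<forall>e\<in>E. 0 < k e) \<longrightarrow>
        (\<lambda>e\<in>E. real_of_int (k e)) \<in> closed_cone E M X \<longrightarrow>
        of_nat (card (nz_flows k)) = f (\<lambda>e. of_int (k e)))"
      using Mpoly[THEN spec, THEN mp, THEN mp, OF units ne] by (elim exE) (rule that)
    note f0 = df[THEN conjunct1]
    have f: "of_nat (card (nz_flows k)) = f (\<lambda>e. of_int (k e))"
      if "\<forall>e\<in>E. 0 < k e" "(\<lambda>e\<in>E. real_of_int (k e)) \<in> closed_cone E M X" for k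
      by (rule df[THEN conjunct2, THEN spec, THEN mp, THEN mp, OF that])
    \<comment> \<open>The construction does not control the degree; the least possible one is found from the growth of the count.\<close>
    define d where "d = (LEAST d. polyfn E d f)"
    have d: "polyfn E d f" unfolding d_def using f0 by (rule LeastI)
    have minimal: "d \<le> d'" if "polyfn E d' f" for d' unfolding d_def using that by (rule Least_le)
    have growth: "\<exists>T A. \<forall>q\<ge>1. of_nat q ^ n \<le> f (\<lambda>e. of_nat (q * T) * of_int (k e)) \<and>
        f (\<lambda>e. of_nat (q * T) * of_int (k e)) \<le> A * of_nat q ^ n \<and> T \<ge> 1"
      if k: "(\<lambda>e. real_of_int (k e)) \<in> chamber E M (side X)" for k
    proof -
      have kpos: "0 < k e" if "e \<in> E" for e
      proof -
        have "sgn (lin E (unit_functional e) (\<lambda>e. real_of_int (k e))) = side X (unit_functional e)"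
          using k units_M that by (auto simp: chamber_def)
        then show ?thesis using units that lin_unit_functional[OF finite_E that, of "\<lambda>e. real_of_int (k e)"]
          by (auto simp: side_def sgn_if split: if_splits)
      qed
      define m where "m = T * (\<Sum>e\<in>E. nat (k e))"
      have "of_nat q ^ n \<le> f (\<lambda>e. of_nat (q * T) * of_int (k e)) \<and>
        f (\<lambda>e. of_nat (q * T) * of_int (k e)) \<le> of_nat ((2 * m + 1) ^ n) * of_nat q ^ n \<and> T \<ge> 1"
        if q: "q \<ge> 1" for q
      proof -
        define k' where "k' = (\<lambda>e. int (q * T) * k e)"
        have qT: "0 < int (q * T)" using q T by simp
        have "(\<lambda>e. real (q * T) * real_of_int (k e)) \<in> chamber E M (side X)"
          using k by (rule chamber_scale) (use q T in simp)
        then have "(\<lambda>e\<in>E. real_of_int (k' e)) \<in> closed_cone E M X"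
          using chamber_subset_closed_cone[of "\<lambda>e. real_of_int (k' e)" E M X] by (simp add: k'_def)
        moreover have "\<forall>e\<in>E. 0 < k' e" using qT kpos by (simp add: k'_def)
        ultimately have "of_nat (card (nz_flows k')) = f (\<lambda>e. of_int (k' e))" by (rule f[rotated])
        also have "(\<lambda>e. rat_of_int (k' e)) = (\<lambda>e. of_nat (q * T) * of_int (k e))"
          by (simp add: k'_def)
        finally have eq: "f (\<lambda>e. of_nat (q * T) * of_int (k e)) = of_nat (card (nz_flows k'))"
          by (rule sym)
        have low_k: "int (q * T) \<le> k' e" if "e \<in> E" for e
          using mult_left_mono[of 1 "k e" "int (q * T)"] kpos[OF that] qT by (simp add: k'_def)
        have "q ^ n \<le> card (nz_flows k')"
          by (rule card_growth[rule_format, OF q, THEN conjunct1, rule_format]) (rule low_k)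
        then have low: "of_nat (q ^ n) \<le> rat_of_nat (card (nz_flows k'))" by (simp only: of_nat_le_iff)
        have up_k: "k' e \<le> int (q * m)" if "e \<in> E" for e
        proof -
          have "nat (k e) \<le> (\<Sum>e\<in>E. nat (k e))" using that finite_E by (intro member_le_sum) auto
          then have "k e \<le> int (\<Sum>e\<in>E. nat (k e))" by linarith
          then have "int (q * T) * k e \<le> int (q * T) * int (\<Sum>e\<in>E. nat (k e))"
            using qT by (intro mult_left_mono) auto
          then show ?thesis by (simp add: k'_def m_def mult_ac)
        qed
        have "card (nz_flows k') \<le> (q * (2 * m + 1)) ^ n"
          by (rule card_growth[rule_format, OF q, THEN conjunct2, rule_format]) (rule up_k)
        moreover have "(q * (2 * m + 1)) ^ n = (2 * m + 1) ^ n * q ^ n"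
          unfolding power_mult_distrib by (rule mult.commute)
        ultimately have "card (nz_flows k') \<le> (2 * m + 1) ^ n * q ^ n" by (rule ord_le_eq_trans)
        then have "rat_of_nat (card (nz_flows k')) \<le> of_nat ((2 * m + 1) ^ n * q ^ n)"
          unfolding of_nat_le_iff .
        then have up: "rat_of_nat (card (nz_flows k')) \<le> of_nat ((2 * m + 1) ^ n) * of_nat q ^ n"
          unfolding of_nat_mult of_nat_power .
        have low: "of_nat q ^ n \<le> rat_of_nat (card (nz_flows k'))"
          using low unfolding of_nat_power .
        show ?thesis unfolding eq by (intro conjI low up T)
      qed
      then show ?thesis by blast
    qed
    have "d = n"
      by (rule minimal_degree_eq_growth[where I = E and W = M and s = "side X" and f = f and d = d and n = n,
          OF finite_E M side_nonzero ne d minimal growth])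
    obtain a where "a \<in> chamber E M (side X)" using ne by auto
    from chamber_contains_box[where s = "side X", OF M finite_E side_nonzero this, of 0]
    obtain z0 :: "'e \<Rightarrow> int" where
      "\<And>z. (\<And>e. e \<in> E \<Longrightarrow> z0 e \<le> z e \<and> z e \<le> z0 e + int 0) \<Longrightarrow> (\<lambda>e. real_of_int (z e)) \<in> chamber E M (side X)"
      by blast
    then have "(\<lambda>e. real_of_int (z0 e)) \<in> chamber E M (side X)" by simp
    from growth[OF this] obtain T A where
      "\<forall>q\<ge>1. of_nat q ^ n \<le> f (\<lambda>e. of_nat (q * T) * of_int (z0 e)) \<and>
        f (\<lambda>e. of_nat (q * T) * of_int (z0 e)) \<le> A * of_nat q ^ n \<and> T \<ge> 1" by blast
    then have "of_nat 1 ^ n \<le> f (\<lambda>e. of_nat (1 * T) * of_int (z0 e))" by blast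
    then have "f (\<lambda>e. of_nat (1 * T) * of_int (z0 e)) \<noteq> 0" by auto
    from mpoly_of_minimal_degree[where E = E and f = f and d = d, OF d minimal this] obtain p where
      "p \<in> polys_over E" "has_total_degree p n" "\<And>x. eval_mpoly p x = f x"
      unfolding \<open>d = n\<close> by blast
    then have "counts X p" using f by (simp add: counts_def)
    then show ?thesis by (rule exI)
  qed
  then obtain p where p: "\<And>X. X \<in> Xs \<Longrightarrow> counts X (p X)" by metis
  obtain N :: nat and g where g: "Xs = g ` {i. i < N}" using finite_imp_nat_seg_image_inj_on[OF \<open>finite Xs\<close>] by blast
  then have gX: "g i \<in> Xs" if "i < N" for i using that by auto
  show ?thesis
    unfolding piecewise_polynomial_of_degree_def n_def[symmetric]
  proof (intro exI[of _ N] exI[of _ "\<lambda>i. closed_cone E M (g i)"] exI[of _ "\<lambda>i. p (g i)"] conjI allI impI ballI)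
    fix i assume i: "i < N"
    show "rational_polyhedral_cone E (closed_cone E M (g i))" by (rule rational_closed_cone[OF M])
    show "full_dimensional E (closed_cone E M (g i))"
      using gX[OF i] by (intro full_dimensional_closed_cone finite_E M) (simp add: Xs_def)
    show "p (g i) \<in> polys_over E" "has_total_degree (p (g i)) n" using p[OF gX[OF i]] by (simp_all add: counts_def)
    fix k :: "'e \<Rightarrow> int"
    assume k: "k \<in> E \<rightarrow>\<^sub>E {0<..}" "(\<lambda>e\<in>E. real_of_int (k e)) \<in> closed_cone E M (g i)"
    show "of_int (int (flow_count V E h t k)) = eval_mpoly (p (g i)) (\<lambda>e. of_int (k e))"
      using p[OF gX[OF i]] k by (simp add: counts_def PiE_iff flow_count_eq_card_nz_flows)
  next
    have "(\<Union>i<N. closed_cone E M (g i)) = (\<Union>X\<in>Xs. closed_cone E M X)" unfolding g by auto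
    also have "\<dots> = (E \<rightarrow>\<^sub>E {0..})"
      unfolding Xs_def using Mnz units_M by (intro closed_cones_cover_orthant finite_E M) auto
    finally show "(\<Union>i<N. closed_cone E M (g i)) = (E \<rightarrow>\<^sub>E {0..})" .
  qed
qed

end

theorem theorem1:
  fixes V :: "'v set" and E :: "'e set" and ends :: "'e \<Rightarrow> 'v set"
    and h t :: "'e \<Rightarrow> 'v"
  assumes "finite_multigraph V E ends"
    and "bridgeless V E ends"
    and "is_orientation E ends h t"
  shows "piecewise_polynomial_of_degree E (\<lambda>k. int (flow_count V E h t k))
           (cyclomatic_number V E ends)"
proof -
  interpret finite_multigraph V E ends by fact
  have ends: "ends e = {h e, t e}" if "e \<in> E" for e
    using assms(3) that by (simp add: is_orientation_def)
  interpret oriented_multigraph V E ends h t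
  proof
    show "h e \<in> V" "t e \<in> V" if "e \<in> E" for e
      using ends_in_V[OF that] ends[OF that] by (auto simp: doubleton_eq_iff)
  qed (use finite_V finite_E ends in auto)
  show ?thesis by (rule piecewise_polynomial_flow_count[OF assms(2)])
qed

end
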